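(* Let $k\geq 2$ be an integer and let $G$ be a simple graph of order $n\geq k^{4}+5k^{3}+2k^{2}+8k+12$ with minimum degree $\delta(G)\geq k$. If $q(G)\geq 2n-2k$, then $G$ is Hamilton-connected unless $G\in \mathcal{S}_{k}^{(1)}(n)\cup \mathcal{T}_{k}^{(1)}(n)$.
   Context: All graphs are finite and simple. For a graph $G$, $Q(G)=D(G)+A(G)$ is the signless Laplacian matrix ($D(G)$ the diagonal degree matrix, $A(G)$ the adjacency matrix), and $q(G)$ denotes its largest eigenvalue. A graph is Hamilton-connected if every two distinct vertices are joined by a Hamilton path. $G+H$ denotes disjoint union, $G\vee H$ the join, $tK_1$ the edgeless graph on $t$ vertices. For $n\geq 5$ and $1\leq k\leq n/2$ define $S_{n}^{k}=K_{k}\vee (K_{n-(2k-1)}+(k-1)K_{1})$ and $T_{n}^{k}=K_{2}\vee (K_{n-(k+1)}+K_{k-1})$. In $S_n^k$ (resp. $T_n^k$) let $Y$ be the set of vertices of degree $n-1$ and $Z$ the set of vertices of degree $n-k$, and let $E_0$ be the set of edges with both endpoints in $Y\cup Z$. Then $\mathcal{S}_{k}^{(1)}(n)$ is the family of graphs $S_{n}^{k}-E'$ with $E'\subseteq E_{0}$ (for $S_n^k$) and $|E'|\leq \lfloor k(k-1)/4\rfloor$, and $\mathcal{T}_{k}^{(1)}(n)$ is the family of graphs $T_{n}^{k}-E'$ with $E'\subseteq E_{0}$ (for $T_n^k$) and $|E'|\leq \lfloor (k-1)/2\rfloor$ (membership understood up to isomorphism). *)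

theory Defs
  imports Main "Jordan_Normal_Form.Char_Poly"
begin

record 'a ugraph =
  verts :: "'a set"
  edges :: "'a set set"

definition simple_graph :: "'a ugraph \<Rightarrow> bool" where
  "simple_graph G \<longleftrightarrow> finite (verts G) \<and> (\<forall>e \<in> edges G. e \<subseteq> verts G \<and> card e = 2)"

definition adjacent :: "'a ugraph \<Rightarrow> 'a \<Rightarrow> 'a \<Rightarrow> bool" where
  "adjacent G u v \<longleftrightarrow> {u, v} \<in> edges G"

definition vertex_degree :: "'a ugraph \<Rightarrow> 'a \<Rightarrow> nat" where
  "vertex_degree G v = card {e \<in> edges G. v \<in> e}"

definition min_degree :: "'a ugraph \<Rightarrow> nat" where
  "min_degree G = Min (vertex_degree G ` verts G)"

definition isomorphic :: "'a ugraph \<Rightarrow> 'b ugraph \<Rightarrow> bool" where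
  "isomorphic G H \<longleftrightarrow>
     (\<exists>f. bij_betw f (verts G) (verts H) \<and>
          (\<forall>u \<in> verts G. \<forall>v \<in> verts G. adjacent G u v \<longleftrightarrow> adjacent H (f u) (f v)))"

definition hamilton_path :: "'a ugraph \<Rightarrow> 'a \<Rightarrow> 'a \<Rightarrow> 'a list \<Rightarrow> bool" where
  "hamilton_path G u v p \<longleftrightarrow>
     p \<noteq> [] \<and> hd p = u \<and> last p = v \<and>
     distinct p \<and> set p = verts G \<and> successively (adjacent G) p"

definition hamilton_connected :: "'a ugraph \<Rightarrow> bool" where
  "hamilton_connected G \<longleftrightarrow>
     (\<forall>u \<in> verts G. \<forall>v \<in> verts G. u \<noteq> v \<longrightarrow> (\<exists>p. hamilton_path G u v p))"

text \<open>Matrices of a graph are written with respect to an ordering \<open>vs\<close> of its vertices.\<close>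

definition vertex_ordering :: "'a ugraph \<Rightarrow> 'a list \<Rightarrow> bool" where
  "vertex_ordering G vs \<longleftrightarrow> distinct vs \<and> set vs = verts G"

definition adjacency_matrix :: "'a ugraph \<Rightarrow> 'a list \<Rightarrow> real mat" where
  "adjacency_matrix G vs =
     mat (length vs) (length vs) (\<lambda>(i, j). if adjacent G (vs ! i) (vs ! j) then 1 else 0)"

definition degree_matrix :: "'a ugraph \<Rightarrow> 'a list \<Rightarrow> real mat" where
  "degree_matrix G vs =
     mat (length vs) (length vs) (\<lambda>(i, j). if i = j then real (vertex_degree G (vs ! i)) else 0)"

definition signless_laplacian :: "'a ugraph \<Rightarrow> 'a list \<Rightarrow> real mat" where
  "signless_laplacian G vs = degree_matrix G vs + adjacency_matrix G vs"

text \<open>Different vertex orderings give permutation-similar matrices, hence the same eigenvalues;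
  quantifying over \<open>vs\<close> only avoids an arbitrary choice.\<close>

definition Q_index :: "'a ugraph \<Rightarrow> real" where
  "Q_index G = Max {x. \<exists>vs. vertex_ordering G vs \<and> eigenvalue (signless_laplacian G vs) x}"

definition complete_graph :: "nat \<Rightarrow> nat ugraph" where
  "complete_graph m = \<lparr>verts = {..<m}, edges = {{i, j} | i j. i < m \<and> j < m \<and> i \<noteq> j}\<rparr>"

definition edgeless_graph :: "nat \<Rightarrow> nat ugraph" where
  "edgeless_graph t = \<lparr>verts = {..<t}, edges = {}\<rparr>"

definition disjoint_union :: "'a ugraph \<Rightarrow> 'b ugraph \<Rightarrow> ('a + 'b) ugraph" where
  "disjoint_union G H =
     \<lparr>verts = verts G <+> verts H,
      edges = (`) Inl ` edges G \<union> (`) Inr ` edges H\<rparr>"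

definition graph_join :: "'a ugraph \<Rightarrow> 'b ugraph \<Rightarrow> ('a + 'b) ugraph" where
  "graph_join G H =
     \<lparr>verts = verts G <+> verts H,
      edges = (`) Inl ` edges G \<union> (`) Inr ` edges H
              \<union> {{Inl u, Inr v} | u v. u \<in> verts G \<and> v \<in> verts H}\<rparr>"

definition delete_edges :: "'a ugraph \<Rightarrow> 'a set set \<Rightarrow> 'a ugraph" where
  "delete_edges G F = \<lparr>verts = verts G, edges = edges G - F\<rparr>"

text \<open>The graphs \<open>S_graph n k\<close> and \<open>T_graph n k\<close> are meant for \<open>n \<ge> 5\<close> and
  \<open>1 \<le> k \<le> n / 2\<close>; no subtraction is truncated in that range.\<close>

definition S_graph :: "nat \<Rightarrow> nat \<Rightarrow> (nat + nat + nat) ugraph" where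
  "S_graph n k =
     graph_join (complete_graph k)
       (disjoint_union (complete_graph (n - (2 * k - 1))) (edgeless_graph (k - 1)))"

definition T_graph :: "nat \<Rightarrow> nat \<Rightarrow> (nat + nat + nat) ugraph" where
  "T_graph n k =
     graph_join (complete_graph 2)
       (disjoint_union (complete_graph (n - (k + 1))) (complete_graph (k - 1)))"

definition Y_set :: "nat \<Rightarrow> 'a ugraph \<Rightarrow> 'a set" where
  "Y_set n H = {v \<in> verts H. vertex_degree H v = n - 1}"

definition Z_set :: "nat \<Rightarrow> nat \<Rightarrow> 'a ugraph \<Rightarrow> 'a set" where
  "Z_set n k H = {v \<in> verts H. vertex_degree H v = n - k}"

definition E0_set :: "nat \<Rightarrow> nat \<Rightarrow> 'a ugraph \<Rightarrow> 'a set set" where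
  "E0_set n k H = {e \<in> edges H. e \<subseteq> Y_set n H \<union> Z_set n k H}"

definition S1_family :: "nat \<Rightarrow> nat \<Rightarrow> 'a ugraph set" where
  "S1_family k n =
     {G. \<exists>E'. E' \<subseteq> E0_set n k (S_graph n k) \<and> card E' \<le> k * (k - 1) div 4 \<and>
              isomorphic G (delete_edges (S_graph n k) E')}"

definition T1_family :: "nat \<Rightarrow> nat \<Rightarrow> 'a ugraph set" where
  "T1_family k n =
     {G. \<exists>E'. E' \<subseteq> E0_set n k (T_graph n k) \<and> card E' \<le> (k - 1) div 2 \<and>
              isomorphic G (delete_edges (T_graph n k) E')}"

end

theory Submission
  imports Defs
begin

text \<open>Write \<open>Q\<close> for the signless Laplacian. Row sums of \<open>D\<^sup>-\<^sup>1 Q D\<close> turn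
  \<open>q(G) \<ge> 2 n - 2 k\<close> into the bound \<open>(k - 1) n\<close> on the number of missing edges. Adding edges as
  long as the graph is not Hamilton-connected gives a supergraph \<open>H\<close> in which nonadjacent vertices
  have degree sum at most \<open>n\<close>; as few edges are missing, the vertices of degree at most \<open>n / 2\<close> in
  \<open>H\<close> form a set \<open>L\<close> of \<open>k - 1\<close> vertices of degree exactly \<open>k\<close>, the remaining vertices form a clique,
  and all of \<open>L\<close> has the same neighbourhood \<open>Y\<close> outside \<open>L\<close>. If \<open>3 \<le> \<bar>Y\<bar> < k\<close> then \<open>H\<close> is
  Hamilton-connected, so \<open>\<bar>Y\<bar> = k\<close> or \<open>\<bar>Y\<bar> = 2\<close>, and \<open>H\<close> is \<open>S\<close> or \<open>T\<close>. The minimum degree forces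
  every edge of \<open>H\<close> at \<open>L\<close> to be in \<open>G\<close>. Finally, evaluating the quadratic form of \<open>Q\<close> at an
  eigenvector shows that, with \<open>s\<close> edges leaving \<open>L\<close>, fewer than about \<open>s / 4\<close> edges outside \<open>L\<close> can
  be missing.\<close>

section \<open>Hamilton paths and degree sums\<close>

text \<open>Degrees and Hamilton paths are phrased for a vertex set and a relation, so that edges
  can be added and vertices dropped without building a new graph record.\<close>

definition nbrs :: "'a set \<Rightarrow> ('a \<Rightarrow> 'a \<Rightarrow> bool) \<Rightarrow> 'a \<Rightarrow> 'a set" where
  "nbrs V R v = {w \<in> V. R v w}"

definition ham_path :: "'a set \<Rightarrow> ('a \<Rightarrow> 'a \<Rightarrow> bool) \<Rightarrow> 'a \<Rightarrow> 'a \<Rightarrow> 'a list \<Rightarrow> bool" where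
  "ham_path V R u v p \<longleftrightarrow> p \<noteq> [] \<and> hd p = u \<and> last p = v \<and> distinct p \<and> set p = V \<and> successively R p"

definition ham_conn :: "'a set \<Rightarrow> ('a \<Rightarrow> 'a \<Rightarrow> bool) \<Rightarrow> bool" where
  "ham_conn V R \<longleftrightarrow> (\<forall>u \<in> V. \<forall>v \<in> V. u \<noteq> v \<longrightarrow> (\<exists>p. ham_path V R u v p))"

lemma finite_nbrs [simp]: "finite V \<Longrightarrow> finite (nbrs V R v)"
  by (simp add: nbrs_def)

lemma nbrs_subset: "nbrs V R v \<subseteq> V"
  by (auto simp: nbrs_def)

lemma successively_complete:
  assumes "distinct p" "set p \<subseteq> V" "\<And>u v. u \<in> V \<Longrightarrow> v \<in> V \<Longrightarrow> u \<noteq> v \<Longrightarrow> R u v"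
  shows "successively R p"
  using assms(1,2)
proof (induction p)
  case (Cons a p)
  then show ?case using assms(3) by (cases p) auto
qed simp

lemma ham_conn_complete:
  assumes "finite V" "\<And>u v. u \<in> V \<Longrightarrow> v \<in> V \<Longrightarrow> u \<noteq> v \<Longrightarrow> R u v"
  shows "ham_conn V R"
  unfolding ham_conn_def
proof (intro ballI impI)
  fix u v assume uv: "u \<in> V" "v \<in> V" "u \<noteq> v"
  obtain xs where xs: "set xs = V - {u, v}" "distinct xs"
    using finite_distinct_list assms(1) by (metis finite_Diff)
  have "successively R (u # xs @ [v])"
    by (rule successively_complete[of _ V]) (use uv xs assms(2) in auto)
  then have "ham_path V R u v (u # xs @ [v])"
    using uv xs by (auto simp: ham_path_def)
  then show "\<exists>p. ham_path V R u v p" ..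
qed

lemma ham_path_rev:
  assumes "ham_path V R u v p" "symp R"
  shows "ham_path V R v u (rev p)"
proof -
  have "(\<lambda>x y. R y x) = R" using assms(2) by (auto simp: symp_def fun_eq_iff)
  then have "successively (\<lambda>x y. R y x) p" using assms by (simp only: ham_path_def)
  then show ?thesis using assms by (auto simp: ham_path_def hd_rev last_rev)
qed

section \<open>Degree-sum closure for Hamilton-connectedness\<close>

lemma card_le_Suc_image:
  assumes "S \<subseteq> insert c (f ` A)" "finite A"
  shows "card S \<le> Suc (card A)"
proof -
  have "card S \<le> card (insert c (f ` A))" using assms by (intro card_mono) auto
  also have "\<dots> \<le> Suc (card (f ` A))" using assms(2) by (simp add: card_insert_if)
  also have "\<dots> \<le> Suc (card A)" using assms(2) by (simp add: card_image_le)
  finally show ?thesis .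
qed

text \<open>The crossing argument of Ore: a path through the new edge \<open>p ! i, p ! (i + 1)\<close> is rerouted
  by reversing a segment that starts or ends at that edge.\<close>

lemma reroute_path:
  assumes p: "ham_path V H' a b p"
    and i: "Suc i < length p"
    and H': "\<And>m. Suc m < length p \<Longrightarrow> m \<noteq> i \<Longrightarrow> H (p ! m) (p ! Suc m)"
    and sym: "symp H"
    and j: "Suc j < length p" "j \<noteq> i" "H (p ! i) (p ! j)" "H (p ! Suc i) (p ! Suc j)"
  shows "\<exists>p'. ham_path V H a b p'"
proof -
  define x y where "x = min i j" and "y = max i j"
  have xy: "x < y" "Suc y < length p" using i j by (auto simp: x_def y_def)
  \<comment> \<open>The path is cut after positions \<open>x\<close> and \<open>y\<close>, and the
    middle block will be reversed. As \<open>i\<close> is \<open>x\<close> or \<open>y\<close>, the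
    edge to be avoided is one of the two cut edges and lies inside no block.\<close>
  define \<alpha> \<beta> \<gamma> where "\<alpha> = take (Suc x) p" and "\<beta> = take (y - x) (drop (Suc x) p)"
    and "\<gamma> = drop (Suc y) p"
  have "take (y - x) (drop (Suc x) p) @ drop (y - x) (drop (Suc x) p) = drop (Suc x) p"
    by (rule append_take_drop_id)
  moreover have "drop (y - x) (drop (Suc x) p) = \<gamma>" using xy by (simp add: \<gamma>_def)
  ultimately have "\<beta> @ \<gamma> = drop (Suc x) p" by (simp add: \<beta>_def)
  then have pdec: "p = \<alpha> @ \<beta> @ \<gamma>" by (simp add: \<alpha>_def)
  have len: "length \<alpha> = Suc x" "length \<beta> = y - x" "length \<gamma> = length p - Suc y"
    using xy by (auto simp: \<alpha>_def \<beta>_def \<gamma>_def)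
  have ne: "\<alpha> \<noteq> []" "\<beta> \<noteq> []" "\<gamma> \<noteq> []" using len xy by auto
  have last\<alpha>: "last \<alpha> = p ! x" using len ne xy by (simp add: last_conv_nth \<alpha>_def)
  have hd\<beta>: "hd \<beta> = p ! Suc x" using len ne xy by (simp add: hd_conv_nth \<beta>_def)
  have last\<beta>: "last \<beta> = p ! y" using len ne xy by (simp add: last_conv_nth \<beta>_def)
  have hd\<gamma>: "hd \<gamma> = p ! Suc y" using len ne xy by (simp add: hd_conv_nth \<gamma>_def)
  have s1: "successively H \<alpha>" using H' xy by (auto simp: successively_conv_nth \<alpha>_def x_def)
  have s2: "successively H \<beta>"
    unfolding successively_conv_nth
  proof (intro allI impI)
    fix m assume m: "Suc m < length \<beta>"
    then have "\<beta> ! m = p ! (Suc x + m)" "\<beta> ! Suc m = p ! Suc (Suc x + m)"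
      using len xy by (auto simp: \<beta>_def)
    moreover have "Suc x + m \<noteq> i" using m len by (auto simp: x_def y_def min_def max_def split: if_splits)
    ultimately show "H (\<beta> ! m) (\<beta> ! Suc m)" using H'[of "Suc x + m"] m len xy by auto
  qed
  have s3: "successively H \<gamma>" using H' xy by (auto simp: successively_conv_nth \<gamma>_def y_def)
  have Heq: "(\<lambda>x y. H y x) = H" using sym by (auto simp: symp_def fun_eq_iff)
  have c1: "H (p ! x) (p ! y)" using j sym by (auto simp: x_def y_def min_def max_def dest: sympD)
  have c2: "H (p ! Suc x) (p ! Suc y)" using j sym
    by (auto simp: x_def y_def min_def max_def dest: sympD)
  have "successively (\<lambda>x y. H y x) \<beta>" using s2 by (simp only: Heq)
  then have "successively H (\<alpha> @ rev \<beta> @ \<gamma>)"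
    using s1 s3 c1 c2 last\<alpha> hd\<beta> last\<beta> hd\<gamma> ne
    by (auto simp: successively_append_iff hd_rev last_rev hd_append)
  moreover have "hd (\<alpha> @ rev \<beta> @ \<gamma>) = hd p" "last (\<alpha> @ rev \<beta> @ \<gamma>) = last p"
    using ne by (auto simp: pdec)
  moreover have "distinct (\<alpha> @ rev \<beta> @ \<gamma>)" "set (\<alpha> @ rev \<beta> @ \<gamma>) = V"
    using p unfolding ham_path_def pdec by auto
  ultimately have "ham_path V H a b (\<alpha> @ rev \<beta> @ \<gamma>)"
    using p ne by (auto simp: ham_path_def)
  then show ?thesis ..
qed

text \<open>Bondy-Chvatal closure with threshold \<open>card V + 1\<close>. On a path with
  \<open>n\<close> vertices through the new edge, the neighbours of \<open>u\<close> and of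
  \<open>v\<close> give two sets of positions of total size at least \<open>n - 1\<close> among only
  \<open>n - 2\<close> candidates; a common position allows rerouting.\<close>

lemma ham_conn_closure_step:
  assumes V: "finite V" and sym: "symp H" and irr: "irreflp H"
    and uv: "u \<in> V" "v \<in> V" "u \<noteq> v"
    and deg: "card (nbrs V H u) + card (nbrs V H v) \<ge> card V + 1"
    and hc: "ham_conn V (\<lambda>x y. H x y \<or> x = u \<and> y = v \<or> x = v \<and> y = u)" (is "ham_conn V ?H'")
  shows "ham_conn V H"
proof -
  have main: "\<exists>p'. ham_path V H a b p'"
    if p: "ham_path V ?H' a b p" and i: "Suc i < length p" "p ! i = u" "p ! Suc i = v" for a b p i
  proof -
    let ?n = "length p"
    have dp: "distinct p" "set p = V" "successively ?H' p" using p by (auto simp: ham_path_def)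
    have n: "card V = ?n" using dp distinct_card by force
    \<comment> \<open>\<open>A\<close> lists neighbours of \<open>u\<close> by their own position
      and can miss only the last vertex of the path; \<open>B\<close> lists neighbours of
      \<open>v\<close> by the preceding position and can miss only the first. Irreflexivity makes
      the exclusion of \<open>i\<close> harmless.\<close>
    define A where "A = {j. Suc j < ?n \<and> j \<noteq> i \<and> H u (p ! j)}"
    define B where "B = {j. Suc j < ?n \<and> j \<noteq> i \<and> H v (p ! Suc j)}"
    have fin: "finite A" "finite B"
      by (rule finite_subset[of _ "{..<?n}"]; force simp: A_def B_def)+
    have "nbrs V H u \<subseteq> insert (p ! (?n - 1)) ((!) p ` A)"
    proof
      fix w assume w: "w \<in> nbrs V H u"
      then obtain j where j: "j < ?n" "p ! j = w" using dp(2) by (auto simp: nbrs_def in_set_conv_nth)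
      show "w \<in> insert (p ! (?n - 1)) ((!) p ` A)"
      proof (cases "Suc j < ?n")
        case True
        have "j \<noteq> i" using w i j irr by (auto simp: nbrs_def irreflp_def)
        then show ?thesis using w j True by (auto simp: A_def nbrs_def)
      next
        case False
        then have "j = ?n - 1" using j by auto
        then show ?thesis using j by auto
      qed
    qed
    then have cA: "card (nbrs V H u) \<le> Suc (card A)"
      using fin by (blast intro: card_le_Suc_image)
    have "nbrs V H v \<subseteq> insert (p ! 0) ((\<lambda>j. p ! Suc j) ` B)"
    proof
      fix w assume w: "w \<in> nbrs V H v"
      then obtain j where j: "j < ?n" "p ! j = w" using dp(2) by (auto simp: nbrs_def in_set_conv_nth)
      show "w \<in> insert (p ! 0) ((\<lambda>j. p ! Suc j) ` B)"
      proof (cases j)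
        case (Suc m)
        have "m \<noteq> i" using w i j Suc irr by (auto simp: nbrs_def irreflp_def)
        then show ?thesis using w j Suc by (auto simp: B_def nbrs_def)
      qed (use j in auto)
    qed
    then have cB: "card (nbrs V H v) \<le> Suc (card B)"
      using fin by (blast intro: card_le_Suc_image)
    have "A \<inter> B \<noteq> {}"
    proof
      assume disj: "A \<inter> B = {}"
      have "A \<union> B \<subseteq> {..<?n - 1} - {i}" by (auto simp: A_def B_def)
      then have "card (A \<union> B) \<le> card ({..<?n - 1} - {i})" by (intro card_mono) auto
      also have "\<dots> = ?n - 2" using i by (subst card_Diff_singleton) auto
      finally have "card A + card B \<le> ?n - 2" using disj fin by (simp add: card_Un_disjoint)
      then show False using cA cB deg n i by linarith
    qed
    then obtain j where j: "j \<in> A" "j \<in> B" by auto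
    show ?thesis
    proof (rule reroute_path[OF p i(1) _ sym, of j])
      fix m assume m: "Suc m < ?n" "m \<noteq> i"
      have "?H' (p ! m) (p ! Suc m)" using dp(3) m by (auto simp: successively_conv_nth)
      moreover have "\<not> (p ! m = u \<and> p ! Suc m = v)"
        using m i dp(1) by (metis Suc_lessD nth_eq_iff_index_eq)
      moreover have "\<not> (p ! m = v \<and> p ! Suc m = u)"
      proof
        assume "p ! m = v \<and> p ! Suc m = u"
        then have "m = Suc i" "Suc m = i"
          using m i nth_eq_iff_index_eq[OF dp(1), of m "Suc i"] nth_eq_iff_index_eq[OF dp(1), of "Suc m" i]
          by auto
        then show False by simp
      qed
      ultimately show "H (p ! m) (p ! Suc m)" by auto
    qed (use j i in \<open>auto simp: A_def B_def\<close>)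
  qed
  have sym': "symp ?H'" using sym by (auto simp: symp_def)
  show ?thesis unfolding ham_conn_def
  proof (intro ballI impI)
    fix a b assume ab: "a \<in> V" "b \<in> V" "a \<noteq> b"
    then obtain p where p: "ham_path V ?H' a b p" using hc by (auto simp: ham_conn_def)
    show "\<exists>p'. ham_path V H a b p'"
    proof (cases "successively H p")
      case True
      then show ?thesis using p by (auto simp: ham_path_def)
    next
      case False
      then obtain i where i: "Suc i < length p" "\<not> H (p ! i) (p ! Suc i)"
        by (auto simp: successively_conv_nth)
      have "?H' (p ! i) (p ! Suc i)" using p i by (auto simp: ham_path_def successively_conv_nth)
      with i consider "p ! i = u" "p ! Suc i = v" | "p ! i = v" "p ! Suc i = u" by auto
      then show ?thesis
      proof cases
        case 1
        then show ?thesis using main[OF p i(1)] by blast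
      next
        \<comment> \<open>A path that runs through the edge from \<open>v\<close> to
          \<open>u\<close> is treated after reversal.\<close>
        case 2
        let ?i = "length p - Suc (Suc i)"
        have "ham_path V ?H' b a (rev p)" by (rule ham_path_rev[OF p sym'])
        moreover have "Suc ?i < length (rev p)" "rev p ! ?i = u" "rev p ! Suc ?i = v"
          using 2 i by (auto simp: rev_nth Suc_diff_Suc)
        ultimately obtain p' where "ham_path V H b a p'" using main by blast
        then show ?thesis using ham_path_rev[OF _ sym] by blast
      qed
    qed
  qed
qed

text \<open>Among the symmetric irreflexive extensions of \<open>R\<close> that are not
  Hamilton-connected, one with the most pairs on \<open>V\<close> is chosen. By the closure step,
  joining a nonadjacent pair of degree sum above \<open>card V\<close> would give a larger extension
  of the same kind.\<close>

lemma maximal_non_ham_conn: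
  assumes V: "finite V" and sym: "symp R" and irr: "irreflp R" and nhc: "\<not> ham_conn V R"
  obtains H where "symp H" "irreflp H" "\<And>u v. R u v \<Longrightarrow> H u v" "\<not> ham_conn V H"
    "\<And>u v. u \<in> V \<Longrightarrow> v \<in> V \<Longrightarrow> u \<noteq> v \<Longrightarrow> \<not> H u v
       \<Longrightarrow> card (nbrs V H u) + card (nbrs V H v) \<le> card V"
proof -
  define P where "P H \<longleftrightarrow> symp H \<and> irreflp H \<and> (\<forall>u v. R u v \<longrightarrow> H u v) \<and> \<not> ham_conn V H" for H
  define f where "f H = card {z \<in> V \<times> V. H (fst z) (snd z)}" for H :: "'a \<Rightarrow> 'a \<Rightarrow> bool"
  have "f H \<le> card (V \<times> V)" for H unfolding f_def using V by (intro card_mono) auto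
  then have "\<forall>H. P H \<longrightarrow> f H < Suc (card (V \<times> V))" by (simp add: less_Suc_eq_le)
  moreover have "P R" using assms by (auto simp: P_def)
  ultimately obtain H where H: "P H" "\<forall>H'. P H' \<longrightarrow> f H' \<le> f H"
    using ex_has_greatest_nat[of P R f] by blast
  show ?thesis
  proof (rule that[of H])
    fix u v assume uv: "u \<in> V" "v \<in> V" "u \<noteq> v" "\<not> H u v"
    let ?H' = "\<lambda>x y. H x y \<or> x = u \<and> y = v \<or> x = v \<and> y = u"
    show "card (nbrs V H u) + card (nbrs V H v) \<le> card V"
    proof (rule ccontr)
      assume "\<not> ?thesis"
      then have "\<not> ham_conn V ?H'"
        using ham_conn_closure_step[OF V _ _ uv(1,2,3), of H] H(1) by (auto simp: P_def)
      then have "P ?H'" using H(1) uv by (auto simp: P_def symp_def irreflp_def)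
      then have "f ?H' \<le> f H" using H by auto
      moreover have "f H < f ?H'" unfolding f_def
      proof (rule psubset_card_mono)
        have "(u, v) \<in> {z \<in> V \<times> V. ?H' (fst z) (snd z)} - {z \<in> V \<times> V. H (fst z) (snd z)}"
          using uv by auto
        then show "{z \<in> V \<times> V. H (fst z) (snd z)} \<subset> {z \<in> V \<times> V. ?H' (fst z) (snd z)}" by blast
      qed (use V in auto)
      ultimately show False by simp
    qed
  qed (use H in \<open>auto simp: P_def\<close>)
qed

text \<open>In a path between old vertices \<open>w\<close> can be inserted next to
  \<open>z\<close>. A path starting at \<open>w\<close> first moves to a neighbour other than the
  target: to \<open>z\<close>, or to \<open>c0\<close> if the target is \<open>z\<close>.\<close>

lemma ham_conn_add_twin:
  assumes hc: "ham_conn V R" and sym: "symp R"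
    and z: "z \<in> V" and w: "w \<notin> V" and zw: "R z w"
    and tw: "\<And>c. c \<in> V \<Longrightarrow> R z c \<Longrightarrow> R w c"
    and ne: "c0 \<in> V" "c0 \<noteq> z" "R z c0"
  shows "ham_conn (insert w V) R"
proof -
  have A: "\<exists>p. ham_path (insert w V) R a b p" if ab: "a \<in> V" "b \<in> V" "a \<noteq> b" for a b
  proof -
    obtain p where p: "ham_path V R a b p" using hc ab by (auto simp: ham_conn_def)
    then have "z \<in> set p" using z by (auto simp: ham_path_def)
    then obtain xs ys where xy: "p = xs @ z # ys" by (meson split_list)
    show ?thesis
    proof (cases ys)
      \<comment> \<open>If \<open>z\<close> is the end of the path, \<open>w\<close> has to go
        before it, following the predecessor of \<open>z\<close>.\<close>
      case Nil
      then have zb: "z = b" using p xy by (auto simp: ham_path_def)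
      then have xs: "xs \<noteq> []" using p xy Nil ab by (auto simp: ham_path_def)
      have "R (last xs) z" "successively R xs" using p xy xs by (auto simp: ham_path_def successively_append_iff)
      moreover have "last xs \<in> V" using p xy xs by (auto simp: ham_path_def)
      ultimately have "R (last xs) w" using tw sym by (auto dest: sympD)
      then have "ham_path (insert w V) R a b (xs @ [w, z])"
        using p xy Nil xs w zw sym \<open>successively R xs\<close>
        by (auto simp: ham_path_def successively_append_iff dest: sympD)
      then show ?thesis ..
    next
      case (Cons c cs)
      have "R z c" "c \<in> V" using p xy Cons by (auto simp: ham_path_def successively_append_iff)
      then have "R w c" using tw by auto
      then have "ham_path (insert w V) R a b (xs @ z # w # c # cs)"
        using p xy Cons w zw
        by (auto simp: ham_path_def successively_append_iff hd_append)
      then show ?thesis ..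
    qed
  qed
  have B: "\<exists>p. ham_path (insert w V) R w b p" if b: "b \<in> V" for b
  proof -
    obtain c where c: "c \<in> V" "c \<noteq> b" "R w c"
      using b z zw tw ne sym by (metis sympD)
    obtain p where p: "ham_path V R c b p" using hc c b by (auto simp: ham_conn_def)
    then have "ham_path (insert w V) R w b (w # p)"
      using c w by (auto simp: ham_path_def successively_Cons)
    then show ?thesis ..
  qed
  show ?thesis unfolding ham_conn_def
    using A B ham_path_rev[OF _ sym] w by (metis insert_iff)
qed

section \<open>Non-Hamilton-connected graphs with few missing edges\<close>

text \<open>\<open>L\<close> consists of the vertices of degree at most \<open>n / 2\<close>; its
  complement is a clique by the degree-sum condition. Counting nonadjacent pairs gives first
  \<open>l < 4 k\<close>, then \<open>d v \<le> l + 1\<close> on \<open>L\<close>, and a second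
  count gives \<open>l \<le> k - 1\<close>. The minimum degree \<open>k\<close> turns all of this
  into equalities.\<close>

lemma low_degree_vertices:
  assumes V: "finite V" "card V = n" and sym: "symp H" and k: "k \<ge> 2"
    and n: "n > k * (8 * k + 1)"
    and deg: "\<And>v. v \<in> V \<Longrightarrow> k \<le> card (nbrs V H v)"
    and nonadj: "card {z \<in> V \<times> V. fst z \<noteq> snd z \<and> \<not> H (fst z) (snd z)} \<le> 2 * (k - 1) * n"
    and ore: "\<And>u v. u \<in> V \<Longrightarrow> v \<in> V \<Longrightarrow> u \<noteq> v \<Longrightarrow> \<not> H u v
       \<Longrightarrow> card (nbrs V H u) + card (nbrs V H v) \<le> n"
    and nhc: "\<not> ham_conn V H"
  obtains L where "L \<subseteq> V" "card L = k - 1" "\<forall>v \<in> L. card (nbrs V H v) = k"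
    "\<forall>u \<in> V - L. \<forall>v \<in> V - L. u \<noteq> v \<longrightarrow> H u v"
    "\<forall>v \<in> L. \<forall>v' \<in> L. \<forall>w \<in> V - L. H v w \<longrightarrow> H v' w"
proof -
  define d where "d v = card (nbrs V H v)" for v
  define N where "N = {z \<in> V \<times> V. fst z \<noteq> snd z \<and> \<not> H (fst z) (snd z)}"
  define L where "L = {v \<in> V. 2 * d v \<le> n}"
  define l where "l = card L"
  have LV: "L \<subseteq> V" and finL: "finite L" using V by (auto simp: L_def)
  have finN: "finite N" unfolding N_def using V by auto
  have cN: "card N \<le> 2 * (k - 1) * n" using nonadj by (simp add: N_def)
  have clique: "H u v" if "u \<in> V - L" "v \<in> V - L" "u \<noteq> v" for u v
  proof (rule ccontr)
    assume "\<not> H u v"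
    then have "d u + d v \<le> n" using ore that by (auto simp: d_def)
    moreover have "2 * d u > n" "2 * d v > n" using that by (auto simp: L_def)
    ultimately show False by linarith
  qed
  have n8: "n > 8 * k * k + k" using n by (simp add: algebra_simps)
  have k4: "8 * k * k \<ge> 16 * k" using k by simp
  have cVL: "card (V - L) = n - l" using V LV finL by (simp add: l_def card_Diff_subset)
  have lV: "l \<le> n" using V LV by (auto simp: l_def intro: card_mono)
  have l4: "l < 4 * k"
  proof (rule ccontr)
    \<comment> \<open>Each vertex of \<open>L\<close> misses at least \<open>(n - 2) / 2\<close>
      others, so \<open>l (n - 2) \<le> 4 (k - 1) n\<close>; for \<open>l \<ge> 4 k\<close> this
      would mean \<open>n \<le> 2 k\<close>.\<close>
    assume "\<not> l < 4 * k"
    have "2 * card (V - {v} - nbrs V H v) \<ge> n - 2" if "v \<in> L" for v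
    proof -
      have "card (V - {v} - nbrs V H v) \<ge> card (V - {v}) - d v" unfolding d_def
        by (intro diff_card_le_card_Diff) (use V in auto)
      moreover have "card (V - {v}) = n - 1" using that LV V by auto
      ultimately show ?thesis using that by (auto simp: L_def)
    qed
    then have "(\<Sum>v\<in>L. n - 2) \<le> (\<Sum>v\<in>L. 2 * card (V - {v} - nbrs V H v))" by (intro sum_mono) auto
    also have "\<dots> = 2 * card (Sigma L (\<lambda>v. V - {v} - nbrs V H v))"
      using V finL by (simp add: sum_distrib_left)
    also have "Sigma L (\<lambda>v. V - {v} - nbrs V H v) \<subseteq> N" using LV by (auto simp: N_def nbrs_def)
    then have "card (Sigma L (\<lambda>v. V - {v} - nbrs V H v)) \<le> card N" by (intro card_mono finN)
    finally have "l * (n - 2) \<le> 4 * (k - 1) * n" using cN by (simp add: l_def)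
    moreover have "4 * k * (n - 2) \<le> l * (n - 2)" using \<open>\<not> l < 4 * k\<close> by (intro mult_right_mono) auto
    ultimately have "4 * k * (n - 2) \<le> 4 * (k - 1) * n" by linarith
    moreover obtain m where "k = Suc m" using k by (cases k) auto
    moreover obtain r where "n = Suc (Suc r)" using n8 k4 k by (cases n; cases "n - 1") auto
    ultimately show False using n8 k4 by (simp add: algebra_simps)
  qed
  have dW: "d w \<ge> n - l - 1" if "w \<in> V - L" for w
  proof -
    have "V - L - {w} \<subseteq> nbrs V H w" using clique that by (auto simp: nbrs_def)
    then have "card (V - L - {w}) \<le> d w" using V by (auto simp: d_def intro: card_mono)
    then show ?thesis using that cVL by simp
  qed
  have dL: "d v \<le> l + 1" if v: "v \<in> L" for v
  proof -
    \<comment> \<open>Otherwise the degree of \<open>v\<close> would be at least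
      \<open>n - l\<close>, which is more than \<open>n / 2\<close>.\<close>
    have "\<exists>w \<in> V - L. \<not> H v w"
    proof (rule ccontr)
      assume "\<not> ?thesis"
      then have "V - L \<subseteq> nbrs V H v" by (auto simp: nbrs_def)
      then have "n - l \<le> d v" using V cVL by (metis d_def card_mono finite_nbrs)
      moreover have "2 * d v \<le> n" using v by (simp add: L_def)
      ultimately show False using l4 n8 k4 by linarith
    qed
    then obtain w where w: "w \<in> V - L" "\<not> H v w" by auto
    then have "d v + d w \<le> n" using ore[of v w] v LV by (auto simp: d_def)
    then show ?thesis using dW[OF w(1)] lV by linarith
  qed
  have lk: "l \<le> k - 1"
  proof (rule ccontr)
    assume "\<not> l \<le> k - 1"
    then have "k \<le> l" by linarith
    then obtain m where m: "l = k + m" using le_Suc_ex by blast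
    have "n - (2 * l + 1) \<le> card (V - L - nbrs V H v)" if "v \<in> L" for v
    proof -
      have "card (V - L - nbrs V H v) \<ge> card (V - L) - d v" unfolding d_def
        by (intro diff_card_le_card_Diff) (use V in auto)
      then show ?thesis using dL[OF that] cVL by auto
    qed
    then have "(\<Sum>v\<in>L. n - (2 * l + 1)) \<le> (\<Sum>v\<in>L. card (V - L - nbrs V H v))" by (intro sum_mono) auto
    then have C: "l * (n - (2 * l + 1)) \<le> card (Sigma L (\<lambda>v. V - L - nbrs V H v))" (is "_ \<le> card ?C")
      using V finL by (simp add: l_def)
    \<comment> \<open>A nonadjacent pair between \<open>L\<close> and its complement lies in
      \<open>N\<close> in both orders, which doubles the count.\<close>
    have "card (?C \<union> prod.swap ` ?C) \<le> card N"
      by (rule card_mono[OF finN]) (use LV sym in \<open>auto simp: N_def nbrs_def dest: sympD\<close>)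
    moreover have "card (?C \<union> prod.swap ` ?C) = card ?C + card (prod.swap ` ?C)"
      by (rule card_Un_disjoint) (use V finL in auto)
    moreover have "card (prod.swap ` ?C) = card ?C" by (rule card_image) auto
    ultimately have "l * (n - (2 * l + 1)) \<le> (k - 1) * n" using C cN by simp
    moreover have "2 * l + 1 \<le> n" using l4 n8 k4 by linarith
    then obtain r where r: "n = 2 * l + 1 + r" using le_Suc_ex by blast
    moreover obtain k' where k': "k = Suc k'" using k by (cases k) auto
    ultimately have "(k + m) * r \<le> k' * n" using m by simp
    then have "(k + m) * n \<le> k' * n + (k + m) * (2 * l + 1)" using r by (simp add: algebra_simps)
    \<comment> \<open>Here \<open>m + 1\<close> is the excess of \<open>l\<close> over
      \<open>k - 1\<close>. From \<open>l < 4 k\<close> and \<open>k + m \<le> k (m + 1)\<close> the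
      right side is at most \<open>(m + 1) k (8 k + 1)\<close>, which the lower bound on
      \<open>n\<close> contradicts.\<close>
    then have "(m + 1) * n \<le> (k + m) * (2 * l + 1)" using k' by (simp add: algebra_simps)
    also have "\<dots> \<le> (k * (m + 1)) * (8 * k + 1)" using l4 k by (intro mult_mono) auto
    also have "\<dots> = (m + 1) * (k * (8 * k + 1))" by (simp only: ac_simps)
    also have "\<dots> < (m + 1) * n" using n by (intro mult_strict_left_mono) auto
    finally show False by simp
  qed
  have "L \<noteq> {}"
  proof
    assume "L = {}"
    then have "ham_conn V H" using clique by (intro ham_conn_complete V) auto
    then show False using nhc by simp
  qed
  then obtain v0 where v0: "v0 \<in> L" by auto
  have degL: "d v = k" "l + 1 = k" if "v \<in> L" for v
  proof -
    have "k \<le> d v" using deg that LV by (auto simp: d_def)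
    then show "d v = k" "l + 1 = k" using dL[OF that] lk k by auto
  qed
  show ?thesis
  proof (rule that[of L])
    show "card L = k - 1" using degL(2)[OF v0] by (simp add: l_def)
    show "\<forall>v \<in> L. \<forall>v' \<in> L. \<forall>w \<in> V - L. H v w \<longrightarrow> H v' w"
    proof (intro ballI impI, rule ccontr)
      fix v v' w assume v: "v \<in> L" "v' \<in> L" "w \<in> V - L" "H v w"
      assume "\<not> H v' w"
      then have 1: "d v' + d w \<le> n" using ore[of v' w] v LV by (auto simp: d_def)
      \<comment> \<open>A vertex \<open>w\<close> of the clique with a neighbour in \<open>L\<close>
        has degree at least \<open>n - l = n - k + 1\<close>; together with a nonneighbour of degree
        \<open>k\<close> this exceeds the permitted sum \<open>n\<close>.\<close>
      have "insert v (V - L - {w}) \<subseteq> nbrs V H w"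
        using clique v LV sym by (auto simp: nbrs_def dest: sympD)
      then have "card (insert v (V - L - {w})) \<le> d w" using V by (auto simp: d_def intro!: card_mono)
      then have "n - l \<le> d w" using v V cVL by (simp add: card_insert_if)
      then show False using 1 degL[OF v(2)] lV by linarith
    qed
  qed (use LV clique degL in \<open>auto simp: d_def\<close>)
qed

text \<open>With \<open>3 \<le> card Y < k\<close> the Ore condition holds on \<open>L\<close>, \<open>Y\<close> and a single further vertex
  \<open>z\<close>; all other vertices are twins of \<open>z\<close>.\<close>

lemma ham_conn_intermediate:
  assumes V: "finite V" and sym: "symp H" and irr: "irreflp H"
    and L: "L \<subseteq> V" "card L = k - 1" "\<And>v. v \<in> L \<Longrightarrow> card (nbrs V H v) = k"
    and clique: "\<And>u v. u \<in> V - L \<Longrightarrow> v \<in> V - L \<Longrightarrow> u \<noteq> v \<Longrightarrow> H u v"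
    and Y: "Y \<subseteq> V - L" "\<And>v w. v \<in> L \<Longrightarrow> w \<in> V - L \<Longrightarrow> H v w \<longleftrightarrow> w \<in> Y"
    and y: "3 \<le> card Y" "card Y < k" and z: "z \<in> V - L - Y"
  shows "ham_conn V H"
proof -
  define V' where "V' = insert z (L \<union> Y)"
  have finL: "finite L" and finY: "finite Y" using V L Y by (auto intro: finite_subset)
  have finV': "finite V'" using finL finY by (simp add: V'_def)
  have cV': "card V' = k + card Y"
  proof -
    have "card (L \<union> Y) = k - 1 + card Y" using finL finY L Y by (subst card_Un_disjoint) auto
    then show ?thesis using z L finL finY y by (auto simp: V'_def card_insert_if)
  qed
  have hcV': "ham_conn V' H"
  proof (rule ccontr)
    \<comment> \<open>A maximal supergraph \<open>M\<close> on \<open>V'\<close> turns out to be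
      complete, a contradiction. Nonadjacent vertices of \<open>M\<close> have degree sum at most
      \<open>k + card Y < 2 k\<close>, so \<open>L\<close> is a clique in \<open>M\<close>.\<close>
    assume "\<not> ham_conn V' H"
    from maximal_non_ham_conn[OF finV' sym irr this] obtain M where M: "symp M" "irreflp M"
      "\<And>u v. H u v \<Longrightarrow> M u v" "\<not> ham_conn V' M"
      "\<And>u v. u \<in> V' \<Longrightarrow> v \<in> V' \<Longrightarrow> u \<noteq> v \<Longrightarrow> \<not> M u v
         \<Longrightarrow> card (nbrs V' M u) + card (nbrs V' M v) \<le> card V'" by blast
    have dL: "k \<le> card (nbrs V' M v)" if v: "v \<in> L" for v
    proof -
      have "nbrs V H v \<subseteq> nbrs V' M v" using M(3) Y(2) v by (auto simp: nbrs_def V'_def)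
      then show ?thesis using L(3)[OF v] finV' by (metis card_mono finite_nbrs)
    qed
    have LL: "M u v" if "u \<in> L" "v \<in> L" "u \<noteq> v" for u v
    proof (rule ccontr)
      assume "\<not> M u v"
      then have "card (nbrs V' M u) + card (nbrs V' M v) \<le> k + card Y"
        using M(5)[of u v] that cV' by (auto simp: V'_def)
      then show False using dL[OF that(1)] dL[OF that(2)] y by linarith
    qed
    have LY: "M u v" if "u \<in> L" "v \<in> Y" for u v
      using that Y M(3) by blast
    \<comment> \<open>Now \<open>u\<close> has degree at least \<open>k - 2 + card Y\<close> and
      \<open>z\<close> at least \<open>card Y\<close>; the sum exceeds \<open>k + card Y\<close>
      because \<open>card Y \<ge> 3\<close>.\<close>
    have Lz: "M u z" if u: "u \<in> L" for u
    proof (rule ccontr)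
      assume "\<not> M u z"
      then have "card (nbrs V' M u) + card (nbrs V' M z) \<le> k + card Y"
        using M(5)[of u z] u cV' z by (auto simp: V'_def)
      moreover have "(L - {u}) \<union> Y \<subseteq> nbrs V' M u" using LL LY u by (auto simp: nbrs_def V'_def)
      then have "card ((L - {u}) \<union> Y) \<le> card (nbrs V' M u)" using finV' by (intro card_mono) auto
      moreover have "card ((L - {u}) \<union> Y) = (k - 2) + card Y"
        using finL finY L Y u by (subst card_Un_disjoint) auto
      moreover have "Y \<subseteq> nbrs V' M z" using M(3) clique[of z] z Y(1) by (auto simp: nbrs_def V'_def)
      then have "card Y \<le> card (nbrs V' M z)" using finV' by (intro card_mono) auto
      ultimately show False using y by linarith
    qed
    have "M u v" if uv: "u \<in> V'" "v \<in> V'" "u \<noteq> v" for u v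
    proof (cases "u \<in> L \<or> v \<in> L")
      case True
      then show ?thesis using uv LL LY Lz sympD[OF M(1)] by (auto simp: V'_def)
    next
      case False
      then have "u \<in> V - L" "v \<in> V - L" using uv z Y(1) by (auto simp: V'_def)
      then show ?thesis using uv(3) clique M(3) by blast
    qed
    then show False using M(4) ham_conn_complete[OF finV'] by blast
  qed
  obtain c0 where c0: "c0 \<in> Y" using y by fastforce
  have "ham_conn (V' \<union> F) H" if "finite F" "F \<subseteq> V - V'" for F
    using that
  proof (induction F)
    case (insert w F)
    have w: "w \<in> V - L - Y" "w \<noteq> z" using insert by (auto simp: V'_def)
    have "ham_conn (insert w (V' \<union> F)) H"
    proof (rule ham_conn_add_twin)
      show "ham_conn (V' \<union> F) H" using insert by auto
      show "z \<in> V' \<union> F" by (simp add: V'_def)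
      show "w \<notin> V' \<union> F" using insert by auto
      show "H z w" using clique w z by auto
      show "c0 \<in> V' \<union> F" "c0 \<noteq> z" "H z c0" using c0 clique z Y by (auto simp: V'_def)
      fix c assume c: "c \<in> V' \<union> F" "H z c"
      \<comment> \<open>As \<open>z\<close> is not in \<open>Y\<close>, its neighbours all lie in
        the clique outside \<open>L\<close>, which also contains \<open>w\<close>.\<close>
      have "c \<notin> L" using c(2) Y(2)[of c z] z sym by (auto dest: sympD)
      moreover have "c \<in> V" using c insert.prems z L Y by (auto simp: V'_def)
      moreover have "c \<noteq> w" using c insert by auto
      ultimately show "H w c" using clique w by auto
    qed (rule sym)
    then show ?case by simp
  qed (use hcV' in simp)
  then have "ham_conn (V' \<union> (V - V')) H" using V by blast
  moreover have "V' \<union> (V - V') = V" using z L Y by (auto simp: V'_def)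
  ultimately show ?thesis by simp
qed

text \<open>The structure is found in a maximal supergraph \<open>H\<close> and carried back to
  \<open>R\<close>: a vertex of \<open>L\<close> has degree \<open>k\<close> in \<open>H\<close> and
  at least \<open>k\<close> in \<open>R\<close>, so no edge at \<open>L\<close> was added.\<close>

lemma non_ham_conn_structure:
  assumes V: "finite V" "card V = n" and sym: "symp R" and irr: "irreflp R" and k: "k \<ge> 2"
    and n: "n > k * (8 * k + 1)"
    and deg: "\<And>v. v \<in> V \<Longrightarrow> k \<le> card (nbrs V R v)"
    and nonadj: "card {z \<in> V \<times> V. fst z \<noteq> snd z \<and> \<not> R (fst z) (snd z)} \<le> 2 * (k - 1) * n"
    and nhc: "\<not> ham_conn V R"
  obtains L Y where "L \<subseteq> V" "card L = k - 1" "Y \<subseteq> V - L"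
    "\<And>v w. v \<in> L \<Longrightarrow> w \<in> V - L \<Longrightarrow> R v w \<longleftrightarrow> w \<in> Y"
    "card Y = k \<and> (\<forall>u \<in> L. \<forall>v \<in> L. \<not> R u v) \<or>
     card Y = 2 \<and> (\<forall>u \<in> L. \<forall>v \<in> L. u \<noteq> v \<longrightarrow> R u v)"
proof -
  from maximal_non_ham_conn[OF V(1) sym irr nhc] obtain H where H: "symp H" "irreflp H"
    "\<And>u v. R u v \<Longrightarrow> H u v" "\<not> ham_conn V H"
    "\<And>u v. u \<in> V \<Longrightarrow> v \<in> V \<Longrightarrow> u \<noteq> v \<Longrightarrow> \<not> H u v
       \<Longrightarrow> card (nbrs V H u) + card (nbrs V H v) \<le> card V" by blast
  have sub: "nbrs V R v \<subseteq> nbrs V H v" for v using H(3) by (auto simp: nbrs_def)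
  have nonadjH: "card {z \<in> V \<times> V. fst z \<noteq> snd z \<and> \<not> H (fst z) (snd z)} \<le> 2 * (k - 1) * n"
    by (rule order.trans[OF card_mono nonadj]) (use V H(3) in auto)
  have degH: "k \<le> card (nbrs V H v)" if "v \<in> V" for v
    using deg[OF that] card_mono[OF finite_nbrs[OF V(1)] sub] by (rule order.trans)
  obtain L where L: "L \<subseteq> V" "card L = k - 1" "\<forall>v \<in> L. card (nbrs V H v) = k"
    "\<forall>u \<in> V - L. \<forall>v \<in> V - L. u \<noteq> v \<longrightarrow> H u v"
    "\<forall>v \<in> L. \<forall>v' \<in> L. \<forall>w \<in> V - L. H v w \<longrightarrow> H v' w"
  proof (rule low_degree_vertices[OF V H(1) k n _ nonadjH _ H(4)])
    show "card (nbrs V H u) + card (nbrs V H v) \<le> n"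
      if "u \<in> V" "v \<in> V" "u \<noteq> v" "\<not> H u v" for u v
      using H(5) that V(2) by simp
  qed (erule degH, rule that, assumption+)
  have finL: "finite L" using V L finite_subset by blast
  obtain v0 where v0: "v0 \<in> L" using L(2) k by fastforce
  define Y where "Y = {w \<in> V - L. H v0 w}"
  have Y: "H v w \<longleftrightarrow> w \<in> Y" if "v \<in> L" "w \<in> V - L" for v w
    using L(5) that v0 unfolding Y_def by blast
  have YV: "Y \<subseteq> V - L" and finY: "finite Y" using V by (auto simp: Y_def)
  have split: "card Y + card (nbrs L H v) = k" if v: "v \<in> L" for v
  proof -
    have "nbrs V H v = Y \<union> nbrs L H v" using Y[OF v] L(1) YV by (auto simp: nbrs_def)
    moreover have "card (Y \<union> nbrs L H v) = card Y + card (nbrs L H v)"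
      by (rule card_Un_disjoint) (use finY finL YV in \<open>auto simp: nbrs_def\<close>)
    ultimately show ?thesis using L(3)[rule_format, OF v] by (simp only:)
  qed
  have degL: "nbrs L H v \<subseteq> L - {v}" for v using H(2) by (auto simp: nbrs_def irreflp_def)
  have cL: "card (L - {v}) = k - 2" if "v \<in> L" for v using that L(2) finL by simp
  \<comment> \<open>A vertex of \<open>L\<close> has \<open>k - card Y\<close> neighbours among the
    \<open>k - 2\<close> other vertices of \<open>L\<close>. Hence \<open>card Y = 2\<close> will
    make \<open>L\<close> a clique, and \<open>card Y = k\<close> will make it independent.\<close>
  have y2: "card Y \<ge> 2"
    using split[OF v0] cL[OF v0] card_mono[OF _ degL[of v0]] finL k by fastforce
  have yk: "card Y \<le> k" using split[OF v0] by linarith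
  have "\<not> (3 \<le> card Y \<and> card Y < k)"
  proof
    assume y: "3 \<le> card Y \<and> card Y < k"
    have "\<exists>z. z \<in> V - L - Y"
    proof (rule ccontr)
      assume "\<not> ?thesis"
      then have "V \<subseteq> L \<union> Y" by auto
      then have "card V \<le> card (L \<union> Y)" using finL finY by (intro card_mono) auto
      also have "\<dots> \<le> card L + card Y" by (rule card_Un_le)
      finally have "n \<le> 2 * k" using V(2) L(2) yk by linarith
      moreover have "2 * k \<le> k * (8 * k + 1)" using k by simp
      ultimately show False using n by linarith
    qed
    then obtain z where "z \<in> V - L - Y" ..
    then have "ham_conn V H"
      using ham_conn_intermediate[OF V(1) H(1,2) L(1,2) _ _ YV Y] L(3,4) y by blast
    then show False using H(4) by simp
  qed
  then have alt: "card Y = k \<or> card Y = 2" using y2 yk by linarith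
  have eq: "nbrs V R v = nbrs V H v" if "v \<in> L" for v
    by (rule card_subset_eq) (use V sub deg[of v] L that card_mono[OF finite_nbrs[OF V(1)] sub[of v]] in auto)
  then have RH: "R v w \<longleftrightarrow> H v w" if "v \<in> L" "w \<in> V" for v w
    using that by (auto simp: nbrs_def)
  show ?thesis
  proof (rule that[of L Y])
    show "R v w \<longleftrightarrow> w \<in> Y" if "v \<in> L" "w \<in> V - L" for v w using Y RH that by auto
    from alt show "card Y = k \<and> (\<forall>u \<in> L. \<forall>v \<in> L. \<not> R u v) \<or>
     card Y = 2 \<and> (\<forall>u \<in> L. \<forall>v \<in> L. u \<noteq> v \<longrightarrow> R u v)"
    proof
      assume c: "card Y = k"
      then have "nbrs L H v = {}" if "v \<in> L" for v using split[OF that] finL by auto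
      then show ?thesis using c H(3) by (auto simp: nbrs_def)
    next
      assume c: "card Y = 2"
      have "nbrs L H v = L - {v}" if "v \<in> L" for v
        by (rule card_subset_eq) (use degL finL cL[OF that] split[OF that] c in auto)
      then have "R u v" if "u \<in> L" "v \<in> L" "u \<noteq> v" for u v
        using that RH L(1) by (fastforce simp: nbrs_def)
      then show ?thesis using c by auto
    qed
  qed (use L YV in auto)
qed

section \<open>Bounds from eigenvectors of the signless Laplacian\<close>

text \<open>Row sums of \<open>D\<^sup>-\<^sup>1 Q D\<close>: a vertex \<open>u\<close> maximising \<open>\<bar>x u\<bar> / d u\<close> satisfies
  \<open>q d(u) \<le> d(u)\<^sup>2 + (\<Sum>v \<sim> u. d(v))\<close>.\<close>

lemma nonadjacent_pairs_le:
  fixes x :: "'a \<Rightarrow> real" and q :: real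
  assumes V: "finite V" "card V = n" and irr: "irreflp R" and k: "k \<ge> 1"
    and deg: "\<And>v. v \<in> V \<Longrightarrow> k \<le> card (nbrs V R v)"
    and eig: "\<And>v. v \<in> V \<Longrightarrow> q * x v = real (card (nbrs V R v)) * x v + (\<Sum>w\<in>nbrs V R v. x w)"
    and nz: "\<exists>v\<in>V. x v \<noteq> 0"
    and q: "q \<ge> 2 * real n - 2 * real k"
  shows "card {z \<in> V \<times> V. fst z \<noteq> snd z \<and> \<not> R (fst z) (snd z)} \<le> 2 * (k - 1) * n"
proof -
  define d where "d v = real (card (nbrs V R v))" for v
  \<comment> \<open>\<open>c v\<close> is the number of edges missing at \<open>v\<close>, so that
    \<open>d v + c v = n - 1\<close> and the row inequality can be read as a bound on missing
    edges.\<close>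
  define c where "c v = real (card (V - {v} - nbrs V R v))" for v
  have n0: "n > 0" using V nz by (auto simp: card_gt_0_iff)
  have dpos: "d v > 0" if "v \<in> V" for v using deg[OF that] k by (simp add: d_def)
  have dc: "d v + c v = real n - 1" if v: "v \<in> V" for v
  proof -
    have "nbrs V R v \<union> (V - {v} - nbrs V R v) = V - {v}" 
      using irr by (auto simp: nbrs_def irreflp_def)
    then have "card (nbrs V R v) + card (V - {v} - nbrs V R v) = card (V - {v})"
      using V by (subst card_Un_disjoint[symmetric]) auto
    also have "\<dots> = n - 1" using v V by simp
    finally have "real (card (nbrs V R v) + card (V - {v} - nbrs V R v)) = real (n - 1)" by simp
    then show ?thesis using n0 by (simp add: d_def c_def)
  qed
  have c0: "c v \<ge> 0" for v by (simp add: c_def)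
  obtain u where u: "u \<in> V" "\<And>v. v \<in> V \<Longrightarrow> \<bar>x v\<bar> / d v \<le> \<bar>x u\<bar> / d u"
  proof -
    let ?f = "\<lambda>v. \<bar>x v\<bar> / d v"
    have "Max (?f ` V) \<in> ?f ` V" using V nz by (intro Max_in) auto
    then obtain u where "u \<in> V" "Max (?f ` V) = ?f u" by auto
    moreover have "?f v \<le> Max (?f ` V)" if "v \<in> V" for v using that V by (intro Max_ge) auto
    ultimately show ?thesis using that by auto
  qed
  have xu: "\<bar>x u\<bar> > 0"
  proof -
    obtain v where v: "v \<in> V" "x v \<noteq> 0" using nz by auto
    then have "0 < \<bar>x v\<bar> / d v" using dpos by auto
    then have "0 < \<bar>x u\<bar> / d u" using u(2)[OF v(1)] by linarith
    then show ?thesis using dpos[OF u(1)] by (simp add: zero_less_divide_iff)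
  qed
  have "q * \<bar>x u\<bar> \<le> d u * \<bar>x u\<bar> + (\<Sum>w\<in>nbrs V R u. d w * (\<bar>x u\<bar> / d u))"
  proof -
    have "q * \<bar>x u\<bar> \<le> \<bar>q * x u\<bar>" by (auto simp: abs_mult intro: mult_right_mono)
    also have "\<dots> \<le> \<bar>d u * x u\<bar> + \<bar>\<Sum>w\<in>nbrs V R u. x w\<bar>"
      unfolding eig[OF u(1)] d_def by (rule abs_triangle_ineq)
    also have "\<dots> \<le> d u * \<bar>x u\<bar> + (\<Sum>w\<in>nbrs V R u. \<bar>x w\<bar>)"
      by (simp add: abs_mult d_def sum_abs)
    also have "(\<Sum>w\<in>nbrs V R u. \<bar>x w\<bar>) \<le> (\<Sum>w\<in>nbrs V R u. d w * (\<bar>x u\<bar> / d u))"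
    proof (rule sum_mono)
      fix w assume "w \<in> nbrs V R u"
      then have w: "w \<in> V" by (simp add: nbrs_def)
      show "\<bar>x w\<bar> \<le> d w * (\<bar>x u\<bar> / d u)"
        using u(2)[OF w] dpos[OF w] by (simp add: pos_divide_le_eq mult.commute)
    qed
    finally show ?thesis by simp
  qed
  also have "\<dots> = (d u * d u + (\<Sum>w\<in>nbrs V R u. d w)) * (\<bar>x u\<bar> / d u)"
  proof -
    have "d u * \<bar>x u\<bar> = d u * d u * (\<bar>x u\<bar> / d u)" using dpos[OF u(1)] by simp
    then show ?thesis by (simp only: sum_distrib_right distrib_right)
  qed
  finally have "q * d u * (\<bar>x u\<bar> / d u) \<le> (d u * d u + (\<Sum>w\<in>nbrs V R u. d w)) * (\<bar>x u\<bar> / d u)"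
    using dpos[OF u(1)] by simp
  then have row: "q * d u \<le> d u * d u + (\<Sum>w\<in>nbrs V R u. d w)"
    by (rule mult_right_le_imp_le) (use xu dpos[OF u(1)] in simp)
  \<comment> \<open>In terms of \<open>c\<close> the row inequality becomes
    \<open>S \<le> d u (2 k - 2 - c u)\<close>; since \<open>S\<close> is nonnegative, it also
    bounds \<open>c u\<close> by \<open>2 k - 2\<close>.\<close>
  define S where "S = (\<Sum>w\<in>nbrs V R u. c w)"
  have S0: "S \<ge> 0" unfolding S_def by (intro sum_nonneg c0)
  have "(\<Sum>w\<in>nbrs V R u. d w) = (\<Sum>w\<in>nbrs V R u. (real n - 1) - c w)"
    by (intro sum.cong) (use dc nbrs_subset in \<open>fastforce simp: algebra_simps\<close>)+
  also have "\<dots> = d u * (real n - 1) - S" by (simp add: sum_subtractf S_def d_def)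
  finally have "q * d u \<le> d u * d u + d u * (real n - 1) - S" using row by simp
  moreover have "(2 * real n - 2 * real k) * d u \<le> q * d u"
    using q dpos[OF u(1)] by (intro mult_right_mono) auto
  ultimately have "S \<le> d u * (d u + (real n - 1) - (2 * real n - 2 * real k))"
    by (simp add: algebra_simps)
  also have "d u = real n - 1 - c u" using dc[OF u(1)] by simp
  then have "d u * (d u + (real n - 1) - (2 * real n - 2 * real k)) = d u * (2 * real k - 2 - c u)"
    by simp
  finally have S: "S \<le> d u * (2 * real k - 2 - c u)" .
  then have "0 \<le> d u * (2 * real k - 2 - c u)" using S0 by linarith
  then have cu: "c u \<le> 2 * real k - 2" using dpos[OF u(1)] by (simp add: zero_le_mult_iff)
  \<comment> \<open>The total is split over \<open>u\<close>, its nonneighbours, where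
    \<open>c v \<le> n - 1\<close> suffices, and its neighbours, which contribute
    \<open>S\<close>.\<close>
  have "(\<Sum>v\<in>V. c v) = (\<Sum>v\<in>insert u (V - {u} - nbrs V R u). c v) + S"
  proof -
    have "V = insert u (V - {u} - nbrs V R u) \<union> nbrs V R u" using u(1) nbrs_subset[of V R u] by auto
    moreover have "insert u (V - {u} - nbrs V R u) \<inter> nbrs V R u = {}"
      using irr by (auto simp: nbrs_def irreflp_def)
    ultimately show ?thesis unfolding S_def using V
      by (metis (no_types, lifting) finite_Un sum.union_disjoint)
  qed
  also have "(\<Sum>v\<in>insert u (V - {u} - nbrs V R u). c v) = c u + (\<Sum>v\<in>V - {u} - nbrs V R u. c v)"
    using V by (subst sum.insert) auto
  also have "(\<Sum>v\<in>V - {u} - nbrs V R u. c v) \<le> (\<Sum>v\<in>V - {u} - nbrs V R u. real n - 1)"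
    by (intro sum_mono) (use dc dpos in \<open>fastforce simp: algebra_simps\<close>)
  also have "\<dots> = c u * (real n - 1)" by (simp add: c_def)
  finally have "(\<Sum>v\<in>V. c v) \<le> c u + c u * (real n - 1) + d u * (2 * real k - 2 - c u)"
    using S by linarith
  also have "\<dots> = c u + c u * (real n - 1) + (real n - 1 - c u) * (2 * real k - 2 - c u)"
    using \<open>d u = real n - 1 - c u\<close> by simp
  \<comment> \<open>The subtracted product is nonnegative as
    \<open>0 \<le> c u \<le> 2 k - 2\<close>, which leaves \<open>(2 k - 2) n\<close>.\<close>
  also have "\<dots> = (2 * real k - 2) * (real n - 1) + c u - c u * (2 * real k - 2 - c u)"
    by (simp add: algebra_simps)
  also have "\<dots> \<le> (2 * real k - 2) * (real n - 1) + (2 * real k - 2)"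
    using cu c0[of u] mult_nonneg_nonneg[of "c u" "2 * real k - 2 - c u"] by linarith
  also have "\<dots> = real (2 * (k - 1) * n)"
  proof -
    have "real (k - 1) = real k - 1" using k by (simp add: of_nat_diff)
    then show ?thesis unfolding of_nat_mult by (simp only:) (simp add: algebra_simps)
  qed
  finally have "(\<Sum>v\<in>V. card (V - {v} - nbrs V R v)) \<le> 2 * (k - 1) * n"
    unfolding c_def by (metis of_nat_le_iff of_nat_sum)
  moreover have "{z \<in> V \<times> V. fst z \<noteq> snd z \<and> \<not> R (fst z) (snd z)} = Sigma V (\<lambda>v. V - {v} - nbrs V R v)"
    by (auto simp: nbrs_def)
  ultimately show ?thesis using V by simp
qed

text \<open>The quadratic form of \<open>D + A\<close> is the sum of
  \<open>(x u + x v)\<^sup>2\<close> over the edges. The sum over ordered pairs meets each edge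
  twice, hence the factor 2.\<close>

lemma rayleigh_identity:
  fixes x :: "'a \<Rightarrow> real"
  assumes V: "finite V" and sym: "symp R"
    and eig: "\<And>v. v \<in> V \<Longrightarrow> q * x v = real (card (nbrs V R v)) * x v + (\<Sum>w\<in>nbrs V R v. x w)"
  shows "2 * q * (\<Sum>v\<in>V. (x v)\<^sup>2) = (\<Sum>u\<in>V. \<Sum>v\<in>V. of_bool (R u v) * (x u + x v)\<^sup>2)"
proof -
  define r :: "'a \<Rightarrow> 'a \<Rightarrow> real" where "r u v = of_bool (R u v)" for u v
  have rsym: "r u v = r v u" for u v using sym by (auto simp: r_def symp_def)
  have nb: "(\<Sum>w\<in>nbrs V R v. f w) = (\<Sum>w\<in>V. r v w * f w)" for f :: "'a \<Rightarrow> real" and v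
  proof -
    have "(\<Sum>w\<in>V. r v w * f w) = (\<Sum>w\<in>V. if R v w then f w else 0)"
      by (intro sum.cong) (auto simp: r_def)
    then show ?thesis using V by (simp add: nbrs_def sum.inter_filter)
  qed
  have dg: "real (card (nbrs V R v)) = (\<Sum>w\<in>V. r v w)" for v using nb[of "\<lambda>_. 1" v] by simp
  have "q * (\<Sum>v\<in>V. (x v)\<^sup>2) = (\<Sum>v\<in>V. x v * (q * x v))"
    by (simp add: sum_distrib_left power2_eq_square algebra_simps)
  also have "\<dots> = (\<Sum>v\<in>V. x v * ((\<Sum>w\<in>V. r v w) * x v + (\<Sum>w\<in>V. r v w * x w)))"
    by (intro sum.cong) (simp_all add: eig nb dg)
  also have "\<dots> = (\<Sum>v\<in>V. \<Sum>w\<in>V. r v w * ((x v)\<^sup>2 + x v * x w))"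
    by (simp add: sum_distrib_left sum_distrib_right power2_eq_square algebra_simps sum.distrib)
  finally have 1: "q * (\<Sum>v\<in>V. (x v)\<^sup>2) = (\<Sum>v\<in>V. \<Sum>w\<in>V. r v w * ((x v)\<^sup>2 + x v * x w))" .
  \<comment> \<open>Exchanging the two indices gives a second expression for the same value; their
    sum completes the square.\<close>
  also have "\<dots> = (\<Sum>v\<in>V. \<Sum>w\<in>V. r v w * ((x w)\<^sup>2 + x v * x w))"
    by (subst sum.swap) (simp add: rsym mult.commute)
  finally have "2 * q * (\<Sum>v\<in>V. (x v)\<^sup>2) = (\<Sum>v\<in>V. \<Sum>w\<in>V. r v w * ((x v)\<^sup>2 + x v * x w))
      + (\<Sum>v\<in>V. \<Sum>w\<in>V. r v w * ((x w)\<^sup>2 + x v * x w))" using 1 by simp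
  also have "\<dots> = (\<Sum>v\<in>V. \<Sum>w\<in>V. r v w * (x v + x w)\<^sup>2)"
    by (simp add: sum.distrib[symmetric] power2_eq_square algebra_simps)
  finally show ?thesis by (simp add: r_def)
qed

text \<open>The sums below run over ordered pairs, so every edge inside \<open>X\<close> or \<open>W\<close> counts twice. On
  \<open>W\<close> the vector is split into its mean \<open>a\<close> and a remainder \<open>y\<close>. With \<open>s\<close> edges between \<open>X\<close> and \<open>W\<close>
  and \<open>p\<close> ordered missing pairs in \<open>W\<close>, the coefficient of \<open>a\<^sup>2\<close> in \<open>2 (q - 2 (N - 1)) \<parallel>x\<parallel>\<^sup>2\<close> is about
  \<open>2 s - 4 p\<close>, and all mixed terms are absorbed by \<open>2 N \<parallel>y\<parallel>\<^sup>2\<close> and \<open>4 (N - 1) \<parallel>x|\<^sub>X\<parallel>\<^sup>2\<close>.\<close>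

lemma missing_pairs_le:
  fixes x :: "'a \<Rightarrow> real" and q :: real and k s :: nat and X W :: "'a set" and R
  defines "s \<equiv> card {z \<in> X \<times> W. R (fst z) (snd z)}"
  assumes fin: "finite X" "finite W" and disj: "X \<inter> W = {}"
    and sym: "symp R" and irr: "irreflp R"
    and cX: "card X = k - 1" and k: "k \<ge> 1"
    and degX: "\<And>i. i \<in> X \<Longrightarrow> card (nbrs (X \<union> W) R i) \<le> k"
    and eig: "\<And>v. v \<in> X \<union> W \<Longrightarrow>
      q * x v = real (card (nbrs (X \<union> W) R v)) * x v + (\<Sum>w\<in>nbrs (X \<union> W) R v. x w)"
    and nz: "\<exists>v \<in> X \<union> W. x v \<noteq> 0"
    and q: "q \<ge> 2 * (real (card W) - 1)"
    and big1: "(real s + 3)\<^sup>2 + 4 * (2 * real s + 3) * (real k - 1) < 2 * real (card W)"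
    and big2: "real k * (2 * real s + 4) < real (card W) - 1"
  shows "2 * card {z \<in> W \<times> W. fst z \<noteq> snd z \<and> \<not> R (fst z) (snd z)} \<le> s + 1"
proof (rule ccontr)
  assume neg: "\<not> ?thesis"
  define M where "M = {z \<in> W \<times> W. fst z \<noteq> snd z \<and> \<not> R (fst z) (snd z)}"
  define N where "N = real (card W)"
  define r :: "'a \<Rightarrow> 'a \<Rightarrow> real" where "r u v = of_bool (R u v)" for u v
  have rsym: "r u v = r v u" for u v using sym by (auto simp: r_def symp_def)
  have r01: "0 \<le> r u v" "r u v \<le> 1" for u v by (auto simp: r_def)
  \<comment> \<open>\<open>p\<close> is the least integer with \<open>2 p \<ge> s + 2\<close>. Only
    \<open>p\<close> of the missing pairs are kept in \<open>F\<close>, so that the error term in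
    \<open>Yq\<close> is at most \<open>(s + 3)\<^sup>2\<close> however many pairs are
    missing.\<close>
  define p where "p = (s + 3) div 2"
  have p: "s + 2 \<le> 2 * p" "2 * p \<le> s + 3" "p \<ge> 1" by (auto simp: p_def)
  have finM: "finite M" unfolding M_def using fin by auto
  have "p \<le> card M" using neg p by (auto simp: M_def)
  then obtain F where F: "F \<subseteq> M" "card F = p" "finite F" by (meson obtain_subset_with_card_n)
  define a where "a = (\<Sum>w\<in>W. x w) / N"
  define y where "y w = x w - a" for w
  define P where "P = (\<Sum>i\<in>X. (x i)\<^sup>2)"
  define Yq where "Yq = (\<Sum>w\<in>W. (y w)\<^sup>2)"
  have "0 \<le> real k * (2 * real s + 4)" by simp
  then have N1: "N > 1" using big2 unfolding N_def by linarith
  have P0: "P \<ge> 0" and Y0: "Yq \<ge> 0" by (auto simp: P_def Yq_def intro: sum_nonneg)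
  have Na: "(\<Sum>w\<in>W. x w) = N * a" using N1 by (simp add: a_def)
  have sq: "(\<Sum>w\<in>W. (x w)\<^sup>2) = N * a\<^sup>2 + Yq"
  proof -
    have "Yq = (\<Sum>w\<in>W. (x w)\<^sup>2 - 2 * a * x w + a\<^sup>2)"
      unfolding Yq_def y_def by (intro sum.cong) (auto simp: power2_eq_square algebra_simps)
    also have "\<dots> = (\<Sum>w\<in>W. (x w)\<^sup>2) - 2 * a * (N * a) + N * a\<^sup>2"
      by (simp add: sum.distrib sum_subtractf sum_distrib_left[symmetric] Na N_def)
    finally show ?thesis by (simp add: power2_eq_square algebra_simps)
  qed
  define E where "E A B = (\<Sum>u\<in>A. \<Sum>v\<in>B. r u v * (x u + x v)\<^sup>2)" for A B
  have "2 * q * (\<Sum>v\<in>X \<union> W. (x v)\<^sup>2) = E (X \<union> W) (X \<union> W)"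
    unfolding E_def r_def by (rule rayleigh_identity) (use fin sym eig in auto)
  moreover have "(\<Sum>v\<in>X \<union> W. (x v)\<^sup>2) = P + (N * a\<^sup>2 + Yq)"
    using fin disj sq by (simp add: sum.union_disjoint P_def)
  moreover have "E (X \<union> W) (X \<union> W) = E X X + 2 * E X W + E W W"
  proof -
    have "E W X = E X W" unfolding E_def by (subst sum.swap) (simp add: rsym add.commute)
    moreover have "E (X \<union> W) (X \<union> W) = E X X + E X W + (E W X + E W W)"
      using fin disj by (simp add: E_def sum.union_disjoint sum.distrib)
    ultimately show ?thesis by simp
  qed
  ultimately have ray: "2 * q * (P + (N * a\<^sup>2 + Yq)) = E X X + 2 * E X W + E W W" by simp
  have degX': "(\<Sum>v\<in>X. r u v) \<le> k" "(\<Sum>v\<in>W. r u v) \<le> k" if u: "u \<in> X" for u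
  proof -
    have "(\<Sum>v\<in>X \<union> W. r u v) = real (card (nbrs (X \<union> W) R u))"
      using fin by (simp add: r_def nbrs_def Int_def)
    then have "(\<Sum>v\<in>X. r u v) + (\<Sum>v\<in>W. r u v) \<le> k"
      using degX[OF u] fin disj by (simp add: sum.union_disjoint)
    moreover have "(\<Sum>v\<in>X. r u v) \<ge> 0" "(\<Sum>v\<in>W. r u v) \<ge> 0" using r01 by (auto intro: sum_nonneg)
    ultimately show "(\<Sum>v\<in>X. r u v) \<le> k" "(\<Sum>v\<in>W. r u v) \<le> k" by linarith+
  qed
  have sq2: "(b + c)\<^sup>2 \<le> 2 * b\<^sup>2 + 2 * c\<^sup>2" for b c :: real
    using sum_squares_bound[of b c] by (simp add: power2_eq_square algebra_simps)
  have EXX: "E X X \<le> 4 * real k * P"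
  proof -
    have "E X X \<le> (\<Sum>u\<in>X. \<Sum>v\<in>X. r u v * (2 * (x u)\<^sup>2 + 2 * (x v)\<^sup>2))"
      unfolding E_def by (intro sum_mono mult_left_mono sq2 r01)
    also have "\<dots> = (\<Sum>u\<in>X. \<Sum>v\<in>X. r u v * (2 * (x u)\<^sup>2)) + (\<Sum>u\<in>X. \<Sum>v\<in>X. r u v * (2 * (x v)\<^sup>2))"
      by (simp add: algebra_simps sum.distrib)
    also have "(\<Sum>u\<in>X. \<Sum>v\<in>X. r u v * (2 * (x v)\<^sup>2)) = (\<Sum>u\<in>X. \<Sum>v\<in>X. r u v * (2 * (x u)\<^sup>2))"
      by (subst sum.swap) (simp add: rsym)
    also have "(\<Sum>u\<in>X. \<Sum>v\<in>X. r u v * (2 * (x u)\<^sup>2)) = (\<Sum>u\<in>X. (\<Sum>v\<in>X. r u v) * (2 * (x u)\<^sup>2))"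
      by (simp add: sum_distrib_right)
    also have "\<dots> \<le> (\<Sum>u\<in>X. real k * (2 * (x u)\<^sup>2))"
      by (intro sum_mono mult_right_mono degX') auto
    finally show ?thesis by (simp add: P_def sum_distrib_left algebra_simps)
  qed
  have rs: "(\<Sum>u\<in>X. \<Sum>v\<in>W. r u v) = real s"
  proof -
    have "(\<Sum>u\<in>X. \<Sum>v\<in>W. r u v) = (\<Sum>z\<in>X \<times> W. of_bool (R (fst z) (snd z)))"
      by (simp add: sum.cartesian_product r_def case_prod_beta)
    also have "\<dots> = real (card ((X \<times> W) \<inter> {z. R (fst z) (snd z)}))"
      using fin by (intro sum_of_bool_eq) auto
    finally show ?thesis by (simp add: s_def Int_def)
  qed
  have EXW: "2 * E X W \<le> (2 * real s + 1) * a\<^sup>2 + (2 * real s + 3) * (4 * real k * P + 4 * (real k - 1) * Yq)"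
  proof -
    \<comment> \<open>The weight makes \<open>s / m \<le> 1 / 2\<close>: splitting off
      \<open>a\<close> raises the coefficient of \<open>a\<^sup>2\<close> in
      \<open>2 * E X W\<close> by at most 1 above \<open>2 s\<close>.\<close>
    define m where "m = 2 * real s + 2"
    have m: "m > 0" by (simp add: m_def)
    have pt: "(a + b)\<^sup>2 \<le> (1 + 1 / m) * a\<^sup>2 + (m + 1) * b\<^sup>2" for b
    proof -
      have "0 \<le> (a - m * b)\<^sup>2 / m" using m by simp
      also have "\<dots> = a\<^sup>2 / m - 2 * a * b + m * b\<^sup>2"
        using m by (simp add: power2_eq_square field_simps)
      finally show ?thesis by (simp add: power2_eq_square algebra_simps)
    qed
    have "E X W \<le> (\<Sum>u\<in>X. \<Sum>v\<in>W. r u v * ((1 + 1 / m) * a\<^sup>2 + (m + 1) * (2 * (x u)\<^sup>2 + 2 * (y v)\<^sup>2)))"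
      unfolding E_def
    proof (intro sum_mono mult_left_mono r01)
      fix u v
      have "(x u + x v)\<^sup>2 = (a + (x u + y v))\<^sup>2" by (simp add: y_def)
      also have "\<dots> \<le> (1 + 1 / m) * a\<^sup>2 + (m + 1) * (x u + y v)\<^sup>2" by (rule pt)
      also have "(m + 1) * (x u + y v)\<^sup>2 \<le> (m + 1) * (2 * (x u)\<^sup>2 + 2 * (y v)\<^sup>2)"
        using m by (intro mult_left_mono sq2) auto
      finally show "(x u + x v)\<^sup>2 \<le> (1 + 1 / m) * a\<^sup>2 + (m + 1) * (2 * (x u)\<^sup>2 + 2 * (y v)\<^sup>2)" by simp
    qed
    also have "\<dots> = (\<Sum>u\<in>X. \<Sum>v\<in>W. r u v * ((1 + 1 / m) * a\<^sup>2) + (m + 1) * 2 * (r u v * (x u)\<^sup>2)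
        + (m + 1) * 2 * (r u v * (y v)\<^sup>2))"
      by (intro sum.cong refl) (simp add: algebra_simps)
    also have "\<dots> = (\<Sum>u\<in>X. \<Sum>v\<in>W. r u v * ((1 + 1 / m) * a\<^sup>2))
        + (m + 1) * 2 * (\<Sum>u\<in>X. \<Sum>v\<in>W. r u v * (x u)\<^sup>2)
        + (m + 1) * 2 * (\<Sum>u\<in>X. \<Sum>v\<in>W. r u v * (y v)\<^sup>2)"
      by (simp only: sum.distrib sum_distrib_left)
    also have "(\<Sum>u\<in>X. \<Sum>v\<in>W. r u v * ((1 + 1 / m) * a\<^sup>2)) = real s * ((1 + 1 / m) * a\<^sup>2)"
      by (simp only: sum_distrib_right[symmetric] rs)
    also have "(\<Sum>u\<in>X. \<Sum>v\<in>W. r u v * (x u)\<^sup>2) \<le> (\<Sum>u\<in>X. real k * (x u)\<^sup>2)"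
      unfolding sum_distrib_right[symmetric] by (intro sum_mono mult_right_mono degX') auto
    also have "\<dots> = real k * P" by (simp add: P_def sum_distrib_left)
    also have "(\<Sum>u\<in>X. \<Sum>v\<in>W. r u v * (y v)\<^sup>2) \<le> (\<Sum>u\<in>X. \<Sum>v\<in>W. 1 * (y v)\<^sup>2)"
      by (intro sum_mono mult_right_mono r01) auto
    also have "\<dots> = (real k - 1) * Yq" using cX k by (simp add: Yq_def of_nat_diff)
    finally have "E X W \<le> real s * ((1 + 1 / m) * a\<^sup>2) + (m + 1) * 2 * (real k * P) 
        + (m + 1) * 2 * ((real k - 1) * Yq)"
      using m by simp
    moreover have "real s * ((1 + 1 / m) * a\<^sup>2) \<le> (real s + 1 / 2) * a\<^sup>2"
    proof -
      have "real s / m \<le> 1 / 2" using m by (simp add: m_def pos_divide_le_eq)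
      then have "real s * (1 + 1 / m) \<le> real s + 1 / 2" by (simp add: algebra_simps)
      then have "real s * (1 + 1 / m) * a\<^sup>2 \<le> (real s + 1 / 2) * a\<^sup>2" by (intro mult_right_mono) auto
      then show ?thesis by (simp add: mult.assoc)
    qed
    ultimately have "E X W \<le> (real s + 1 / 2) * a\<^sup>2 + (m + 1) * 2 * (real k * P) 
        + (m + 1) * 2 * ((real k - 1) * Yq)" by linarith
    then have "2 * E X W \<le> 2 * ((real s + 1 / 2) * a\<^sup>2 + (m + 1) * 2 * (real k * P) 
        + (m + 1) * 2 * ((real k - 1) * Yq))" by (rule mult_left_mono) simp
    also have "\<dots> = (2 * real s + 1) * a\<^sup>2 
        + (2 * real s + 3) * (4 * real k * P + 4 * (real k - 1) * Yq)"
      by (simp add: m_def algebra_simps)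
    finally show ?thesis .
  qed
  define SM where "SM = (\<Sum>z\<in>M. (x (fst z) + x (snd z))\<^sup>2)"
  \<comment> \<open>The form of the complete graph on \<open>W\<close> is evaluated exactly, and the
    missing pairs are subtracted as \<open>SM\<close>.\<close>
  have EWW: "E W W = 4 * N * (N - 1) * a\<^sup>2 + (2 * N - 4) * Yq - SM"
  proof -
    have "(\<Sum>u\<in>W. \<Sum>v\<in>W. (x u + x v)\<^sup>2) = (\<Sum>u\<in>W. \<Sum>v\<in>W. (x u)\<^sup>2 + (x v)\<^sup>2 + 2 * (x u * x v))"
      by (intro sum.cong) (auto simp: power2_eq_square algebra_simps)
    also have "\<dots> = 2 * N * (\<Sum>w\<in>W. (x w)\<^sup>2) + 2 * ((\<Sum>w\<in>W. x w) * (\<Sum>w\<in>W. x w))"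
      by (simp add: sum.distrib sum_product sum_distrib_left[symmetric] N_def)
    finally have all: "(\<Sum>u\<in>W. \<Sum>v\<in>W. (x u + x v)\<^sup>2) = 2 * N * (N * a\<^sup>2 + Yq) + 2 * ((N * a) * (N * a))"
      by (simp add: sq Na)
    have "SM = (\<Sum>z\<in>W \<times> W. of_bool (fst z \<noteq> snd z \<and> \<not> R (fst z) (snd z)) * (x (fst z) + x (snd z))\<^sup>2)"
      unfolding SM_def M_def using fin by (intro sum.mono_neutral_cong_left) auto
    also have "\<dots> = (\<Sum>u\<in>W. \<Sum>v\<in>W. of_bool (u \<noteq> v \<and> \<not> R u v) * (x u + x v)\<^sup>2)"
      by (simp add: sum.cartesian_product case_prod_beta)
    also have "\<dots> = (\<Sum>u\<in>W. \<Sum>v\<in>W. (x u + x v)\<^sup>2 - of_bool (u = v) * (x u + x v)\<^sup>2 - r u v * (x u + x v)\<^sup>2)"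
      by (intro sum.cong refl) (use irr in \<open>auto simp: r_def irreflp_def\<close>)
    also have "\<dots> = (\<Sum>u\<in>W. \<Sum>v\<in>W. (x u + x v)\<^sup>2) 
        - (\<Sum>u\<in>W. \<Sum>v\<in>W. of_bool (u = v) * (x u + x v)\<^sup>2) - E W W"
      by (simp add: sum_subtractf E_def)
    also have "(\<Sum>u\<in>W. \<Sum>v\<in>W. of_bool (u = v) * (x u + x v)\<^sup>2) = (\<Sum>u\<in>W. 4 * (x u)\<^sup>2)"
    proof (intro sum.cong refl)
      fix u assume "u \<in> W"
      have "(\<Sum>v\<in>W. of_bool (u = v) * (x u + x v)\<^sup>2) = (\<Sum>v\<in>W. if u = v then (x u + x v)\<^sup>2 else 0)"
        by (intro sum.cong) auto
      then show "(\<Sum>v\<in>W. of_bool (u = v) * (x u + x v)\<^sup>2) = 4 * (x u)\<^sup>2"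
        using \<open>u \<in> W\<close> fin by (simp add: power2_eq_square)
    qed
    finally have "E W W = 2 * N * (N * a\<^sup>2 + Yq) + 2 * ((N * a) * (N * a)) - 4 * (N * a\<^sup>2 + Yq) - SM"
      using all sq by (simp add: sum_distrib_left[symmetric])
    then show ?thesis by (simp add: power2_eq_square algebra_simps)
  qed
  have SM: "(2 * real s + 2) * a\<^sup>2 - (real s + 3)\<^sup>2 * Yq \<le> SM"
  proof -
    \<comment> \<open>The weight \<open>2 / p\<close> is chosen so that the \<open>p\<close> pairs
      of \<open>F\<close> together lose only \<open>2 a\<^sup>2\<close>; what remains is
      \<open>(4 p - 2) a\<^sup>2 \<ge> (2 s + 2) a\<^sup>2\<close>.\<close>
    have pt: "(4 - 2 / real p) * a\<^sup>2 - 2 * real p * (2 * Yq) \<le> (x (fst z) + x (snd z))\<^sup>2" if z: "z \<in> F" for z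
    proof -
      obtain u v where uv: "z = (u, v)" "u \<in> W" "v \<in> W" "u \<noteq> v"
        using z F(1) by (auto simp: M_def)
      define b where "b = y u + y v"
      have "(\<Sum>w\<in>{u, v}. (y w)\<^sup>2) \<le> Yq"
        unfolding Yq_def using uv fin by (intro sum_mono2) auto
      then have "b\<^sup>2 \<le> 2 * Yq" using uv(4) sq2[of "y u" "y v"] by (simp add: b_def)
      then have "2 * real p * b\<^sup>2 \<le> 2 * real p * (2 * Yq)" by (intro mult_left_mono) auto
      moreover have "(4 - 2 / real p) * a\<^sup>2 - 2 * real p * b\<^sup>2 \<le> (2 * a + b)\<^sup>2"
      proof -
        have "0 \<le> 2 * (a + real p * b)\<^sup>2 / real p + b\<^sup>2" by simp
        also have "\<dots> = (2 * a + b)\<^sup>2 - ((4 - 2 / real p) * a\<^sup>2 - 2 * real p * b\<^sup>2)"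
          using p(3) by (simp add: power2_eq_square field_simps)
        finally show ?thesis by simp
      qed
      ultimately have "(4 - 2 / real p) * a\<^sup>2 - 2 * real p * (2 * Yq) \<le> (2 * a + b)\<^sup>2"
        by linarith
      moreover have "x u + x v = 2 * a + b" by (simp add: b_def y_def)
      ultimately have "(4 - 2 / real p) * a\<^sup>2 - 2 * real p * (2 * Yq) \<le> (x u + x v)\<^sup>2"
        by simp
      then show ?thesis using uv(1) by simp
    qed
    have "(\<Sum>z\<in>F. (4 - 2 / real p) * a\<^sup>2 - 2 * real p * (2 * Yq)) \<le> (\<Sum>z\<in>F. (x (fst z) + x (snd z))\<^sup>2)"
      by (intro sum_mono pt)
    also have "\<dots> \<le> SM" unfolding SM_def using F finM by (intro sum_mono2) auto
    also have "(\<Sum>z\<in>F. (4 - 2 / real p) * a\<^sup>2 - 2 * real p * (2 * Yq)) 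
        = real p * ((4 - 2 / real p) * a\<^sup>2 - 2 * real p * (2 * Yq))"
      using F by simp
    also have "\<dots> = (4 * real p - 2) * a\<^sup>2 - (2 * real p)\<^sup>2 * Yq"
      using p(3) by (simp add: power2_eq_square field_simps)
    finally have 1: "(4 * real p - 2) * a\<^sup>2 - (2 * real p)\<^sup>2 * Yq \<le> SM" .
    have "(2 * real s + 2) * a\<^sup>2 \<le> (4 * real p - 2) * a\<^sup>2"
      using p(1) by (intro mult_right_mono) auto
    moreover have "(2 * real p)\<^sup>2 * Yq \<le> (real s + 3)\<^sup>2 * Yq"
      using p(2) Y0 by (intro mult_right_mono power_mono) auto
    ultimately show ?thesis using 1 by linarith
  qed
  have "4 * (N - 1) * (P + (N * a\<^sup>2 + Yq)) \<le> 2 * q * (P + (N * a\<^sup>2 + Yq))"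
    using q P0 Y0 N1 by (intro mult_right_mono) (auto simp: N_def)
  then have "4 * (N - 1) * (P + (N * a\<^sup>2 + Yq)) \<le> 4 * real k * P 
      + ((2 * real s + 1) * a\<^sup>2 + (2 * real s + 3) * (4 * real k * P + 4 * (real k - 1) * Yq))
      + (4 * N * (N - 1) * a\<^sup>2 + (2 * N - 4) * Yq) - ((2 * real s + 2) * a\<^sup>2 - (real s + 3)\<^sup>2 * Yq)"
    using ray EXX EXW EWW SM by linarith
  \<comment> \<open>The terms \<open>4 N (N - 1) a\<^sup>2\<close> cancel, and
    \<open>2 s + 2\<close> against \<open>2 s + 1\<close> leaves one \<open>a\<^sup>2\<close>. With
    the other two coefficients positive by \<open>big1\<close> and \<open>big2\<close>, the whole
    eigenvector must vanish.\<close>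
  then have key: "a\<^sup>2 + 4 * (N - 1 - real k * (2 * real s + 4)) * P
      + (2 * N - ((real s + 3)\<^sup>2 + 4 * (2 * real s + 3) * (real k - 1))) * Yq \<le> 0"
    by (simp add: algebra_simps)
  define \<alpha> where "\<alpha> = 4 * (N - 1 - real k * (2 * real s + 4))"
  define \<beta> where "\<beta> = 2 * N - ((real s + 3)\<^sup>2 + 4 * (2 * real s + 3) * (real k - 1))"
  have pos: "\<alpha> > 0" "\<beta> > 0" using big1 big2 by (auto simp: \<alpha>_def \<beta>_def N_def)
  have "0 \<le> \<alpha> * P" "0 \<le> \<beta> * Yq" "0 \<le> a\<^sup>2" using pos P0 Y0 by auto
  moreover have "a\<^sup>2 + \<alpha> * P + \<beta> * Yq \<le> 0" using key by (simp add: \<alpha>_def \<beta>_def)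
  ultimately have "\<alpha> * P = 0" "\<beta> * Yq = 0" "a\<^sup>2 = 0" by linarith+
  then have z: "P = 0" "Yq = 0" "a = 0" using pos by auto
  then have "\<forall>i\<in>X. x i = 0" "\<forall>w\<in>W. x w = 0"
    using fin by (auto simp: P_def Yq_def y_def sum_nonneg_eq_0_iff)
  then show False using nz by auto
qed

section \<open>From graph records and matrices to relations and eigenfunctions\<close>

lemma adjacent_simps:
  assumes "simple_graph G"
  shows symp_adjacent: "symp (adjacent G)" and irreflp_adjacent: "irreflp (adjacent G)"
    and adjacent_verts: "adjacent G u v \<Longrightarrow> u \<in> verts G \<and> v \<in> verts G"
  using assms by (auto simp: simple_graph_def adjacent_def symp_def irreflp_def insert_commute)

lemma vertex_degree_eq:
  assumes G: "simple_graph G"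
  shows "vertex_degree G v = card (nbrs (verts G) (adjacent G) v)"
proof -
  have "{e \<in> edges G. v \<in> e} = (\<lambda>u. {v, u}) ` nbrs (verts G) (adjacent G) v"
  proof (intro equalityI subsetI)
    fix e assume e: "e \<in> {e \<in> edges G. v \<in> e}"
    then have "card e = 2" using G by (auto simp: simple_graph_def)
    then obtain u where "e = {v, u}" using e by (auto simp: card_2_iff)
    then show "e \<in> (\<lambda>u. {v, u}) ` nbrs (verts G) (adjacent G) v"
      using e adjacent_verts[OF G, of v u] by (auto simp: nbrs_def adjacent_def)
  qed (auto simp: nbrs_def adjacent_def)
  moreover have "inj_on (\<lambda>u. {v, u}) (nbrs (verts G) (adjacent G) v)"
    by (auto simp: inj_on_def doubleton_eq_iff)
  ultimately show ?thesis by (simp add: vertex_degree_def card_image)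
qed

lemma signless_laplacian_carrier:
  "signless_laplacian G vs \<in> carrier_mat (length vs) (length vs)"
  by (simp add: signless_laplacian_def degree_matrix_def adjacency_matrix_def)

text \<open>Reindexing the eigenvector by vertices instead of positions removes the ordering
  \<open>vs\<close> from the spectral bounds.\<close>

lemma signless_laplacian_eigenfunction:
  assumes G: "simple_graph G" and vs: "vertex_ordering G vs"
    and q: "eigenvalue (signless_laplacian G vs) q"
  obtains x :: "'a \<Rightarrow> real" where "\<exists>v \<in> verts G. x v \<noteq> 0"
    "\<forall>v \<in> verts G. q * x v = real (card (nbrs (verts G) (adjacent G) v)) * x v
       + (\<Sum>w\<in>nbrs (verts G) (adjacent G) v. x w)"
proof -
  let ?n = "length vs" and ?V = "verts G" and ?A = "signless_laplacian G vs"
  have V: "set vs = ?V" "distinct vs" "finite ?V"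
    using vs G by (auto simp: vertex_ordering_def simple_graph_def)
  obtain y where y: "y \<in> carrier_vec ?n" "y \<noteq> 0\<^sub>v ?n" "?A *\<^sub>v y = q \<cdot>\<^sub>v y"
    using q signless_laplacian_carrier[of G vs] by (auto simp: eigenvalue_def eigenvector_def)
  have bij: "bij_betw ((!) vs) {0..<?n} ?V" by (rule bij_betw_nth) (use V in auto)
  define x where "x v = y $ the_inv_into {0..<?n} ((!) vs) v" for v
  have x: "x (vs ! i) = y $ i" if "i < ?n" for i
    using that bij by (simp add: x_def the_inv_into_f_f bij_betw_def)
  show ?thesis
  proof (rule that[of x])
    obtain i where "i < ?n" "y $ i \<noteq> 0" using y(1,2) by (auto simp: vec_eq_iff)
    then show "\<exists>v \<in> ?V. x v \<noteq> 0" using x V by (metis nth_mem)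
    show "\<forall>v \<in> ?V. q * x v = real (card (nbrs ?V (adjacent G) v)) * x v
       + (\<Sum>w\<in>nbrs ?V (adjacent G) v. x w)"
    proof
      fix v assume "v \<in> ?V"
      then obtain i where i: "i < ?n" "v = vs ! i" using V by (metis in_set_conv_nth)
      have "q * y $ i = (?A *\<^sub>v y) $ i" using y i by simp
      also have "\<dots> = (\<Sum>j\<in>{0..<?n}. ?A $$ (i, j) * y $ j)"
        using y(1) i signless_laplacian_carrier[of G vs] by (auto simp: scalar_prod_def)
      also have "\<dots> = (\<Sum>j\<in>{0..<?n}. (if i = j then real (vertex_degree G v) * x v else 0)
          + (if adjacent G v (vs ! j) then x (vs ! j) else 0))"
        by (intro sum.cong refl)
          (use i x in \<open>auto simp: signless_laplacian_def degree_matrix_def adjacency_matrix_def algebra_simps\<close>)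
      also have "\<dots> = real (vertex_degree G v) * x v
          + (\<Sum>j\<in>{0..<?n}. if adjacent G v (vs ! j) then x (vs ! j) else 0)"
        using i by (simp add: sum.distrib)
      also have "(\<Sum>j\<in>{0..<?n}. if adjacent G v (vs ! j) then x (vs ! j) else 0)
          = (\<Sum>w\<in>?V. if adjacent G v w then x w else 0)"
        by (rule sum.reindex_bij_betw[OF bij])
      also have "\<dots> = (\<Sum>w\<in>nbrs ?V (adjacent G) v. x w)"
        using V by (simp add: nbrs_def sum.inter_filter)
      finally show "q * x v = real (card (nbrs ?V (adjacent G) v)) * x v
         + (\<Sum>w\<in>nbrs ?V (adjacent G) v. x w)"
        using i x by (simp add: vertex_degree_eq[OF G])
    qed
  qed
qed

text \<open>The fundamental theorem of algebra yields a complex eigenvalue; symmetry makes it real.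
  This guarantees that the set whose maximum defines \<open>Q_index\<close> is nonempty.\<close>

lemma symmetric_real_mat_eigenvalue:
  fixes A :: "real mat"
  assumes A: "A \<in> carrier_mat n n" and sym: "A\<^sup>T = A" and n: "n > 0"
  shows "\<exists>q. eigenvalue A q"
proof -
  let ?h = "complex_of_real"
  let ?B = "map_mat ?h A"
  have B: "?B \<in> carrier_mat n n" using A by simp
  have "degree (char_poly ?B) = n" using degree_monic_char_poly[OF B] by simp
  then have "\<not> constant (poly (char_poly ?B))" using n by (simp add: constant_degree)
  then obtain z where z: "poly (char_poly ?B) z = 0" using fundamental_theorem_of_algebra by blast
  then obtain v where v: "v \<in> carrier_vec n" "v \<noteq> 0\<^sub>v n" "?B *\<^sub>v v = z \<cdot>\<^sub>v v"
    using B eigenvalue_root_char_poly[OF B] by (auto simp: eigenvalue_def eigenvector_def)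
  have row: "z * v $ i = (\<Sum>j\<in>{0..<n}. ?h (A $$ (i, j)) * v $ j)" if i: "i < n" for i
  proof -
    have "z * v $ i = (?B *\<^sub>v v) $ i" using v i by simp
    also have "\<dots> = (\<Sum>j\<in>{0..<n}. ?h (A $$ (i, j)) * v $ j)"
      using v(1) i A by (auto simp: scalar_prod_def)
    finally show ?thesis .
  qed
  have Asym: "A $$ (i, j) = A $$ (j, i)" if "i < n" "j < n" for i j
    using arg_cong[OF sym, of "\<lambda>M. M $$ (j, i)"] A that by simp
  \<comment> \<open>\<open>F\<close> is the Hermitian form at \<open>v\<close>: it equals its own
    conjugate by symmetry and also \<open>z\<close> times the positive real
    \<open>N\<close>.\<close>
  define F where "F = (\<Sum>i\<in>{0..<n}. \<Sum>j\<in>{0..<n}. cnj (v $ i) * (?h (A $$ (i, j)) * v $ j))"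
  define N where "N = (\<Sum>i\<in>{0..<n}. (cmod (v $ i))\<^sup>2)"
  have "cnj F = (\<Sum>i\<in>{0..<n}. \<Sum>j\<in>{0..<n}. cnj (v $ j) * (?h (A $$ (i, j)) * v $ i))"
    by (simp add: F_def mult.commute mult.left_commute)
  also have "\<dots> = (\<Sum>j\<in>{0..<n}. \<Sum>i\<in>{0..<n}. cnj (v $ j) * (?h (A $$ (i, j)) * v $ i))"
    by (rule sum.swap)
  also have "\<dots> = F" unfolding F_def by (intro sum.cong refl) (simp add: Asym)
  finally have F: "cnj F = F" .
  have "F = (\<Sum>i\<in>{0..<n}. cnj (v $ i) * (z * v $ i))"
    unfolding F_def sum_distrib_left[symmetric] by (intro sum.cong refl) (simp add: row)
  also have "\<dots> = z * ?h N"
    by (simp add: N_def sum_distrib_left complex_norm_square mult.commute mult.left_commute del: of_real_power)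
  finally have zN: "F = z * ?h N" .
  obtain i where i: "i < n" "v $ i \<noteq> 0" using v by (auto simp: vec_eq_iff)
  have "0 < (cmod (v $ i))\<^sup>2" using i by simp
  also have "\<dots> \<le> N" unfolding N_def using i by (intro member_le_sum) auto
  finally have N: "N > 0" .
  have "cnj z = z" using F N by (simp add: zN)
  then have "z = ?h (Re z)" by (simp add: complex_eq_iff)
  moreover have "char_poly ?B = map_poly ?h (char_poly A)" by (rule of_real_hom.char_poly_hom[OF A])
  ultimately have "?h (poly (char_poly A) (Re z)) = 0"
    using z by (metis of_real_hom.poly_map_poly)
  then have "eigenvalue A (Re z)" using eigenvalue_root_char_poly[OF A] by simp
  then show ?thesis ..
qed

text \<open>The maximum is attained: there are finitely many orderings, each characteristic
  polynomial has finitely many roots, and some real eigenvalue exists.\<close>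

lemma Q_index_eigenvalue:
  assumes G: "simple_graph G" and ne: "verts G \<noteq> {}"
  obtains vs where "vertex_ordering G vs" "eigenvalue (signless_laplacian G vs) (Q_index G)"
proof -
  define S where "S = {x. \<exists>vs. vertex_ordering G vs \<and> eigenvalue (signless_laplacian G vs) x}"
  have fin: "finite (verts G)" using G by (simp add: simple_graph_def)
  have "finite {vs. vertex_ordering G vs}"
    by (rule finite_subset[OF _ finite_lists_length_eq[OF fin, of "card (verts G)"]])
      (auto simp: vertex_ordering_def distinct_card[symmetric])
  moreover have "finite {x. eigenvalue (signless_laplacian G vs) x}" for vs
  proof -
    have "char_poly (signless_laplacian G vs) \<noteq> 0"
      using degree_monic_char_poly[OF signless_laplacian_carrier] by (metis coeff_0 zero_neq_one)
    then show ?thesis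
      using poly_roots_finite by (simp add: eigenvalue_root_char_poly[OF signless_laplacian_carrier])
  qed
  ultimately have "finite (\<Union>vs\<in>{vs. vertex_ordering G vs}. {x. eigenvalue (signless_laplacian G vs) x})"
    by blast
  also have "(\<Union>vs\<in>{vs. vertex_ordering G vs}. {x. eigenvalue (signless_laplacian G vs) x}) = S"
    by (auto simp: S_def)
  finally have finS: "finite S" .
  obtain vs where vs: "vertex_ordering G vs"
    using finite_distinct_list[OF fin] by (auto simp: vertex_ordering_def)
  have "(signless_laplacian G vs)\<^sup>T = signless_laplacian G vs"
    using symp_adjacent[OF G]
    by (intro eq_matI) (auto simp: signless_laplacian_def degree_matrix_def adjacency_matrix_def dest: sympD)
  moreover have "length vs > 0" using vs ne by (auto simp: vertex_ordering_def)
  ultimately have "S \<noteq> {}"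
    using symmetric_real_mat_eigenvalue[OF signless_laplacian_carrier] vs unfolding S_def by blast
  then have "Max S \<in> S" using finS by (rule Max_in[rotated])
  then show ?thesis using that by (auto simp: S_def Q_index_def)
qed

section \<open>Joins with edges removed\<close>

text \<open>Each doubleton has exactly the two preimages \<open>(u, v)\<close> and
  \<open>(v, u)\<close>. This converts ordered missing pairs into deleted edges.\<close>

lemma card_unordered_pairs:
  assumes M: "finite M" and sym: "\<And>u v. (u, v) \<in> M \<Longrightarrow> (v, u) \<in> M" and irr: "\<And>u. (u, u) \<notin> M"
    and inj: "inj_on f A" and MA: "M \<subseteq> A \<times> A"
  shows "2 * card ((\<lambda>(u, v). {f u, f v}) ` M) = card M"
proof -
  let ?g = "\<lambda>(u, v). {f u, f v}"
  have "card {z \<in> M. ?g z = e} = 2" if e: "e \<in> ?g ` M" for e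
  proof -
    obtain z where "e = ?g z" "z \<in> M" using e by (rule imageE)
    then obtain u v where uv: "(u, v) \<in> M" "e = {f u, f v}" by (cases z) auto
    have "z = (u, v) \<or> z = (v, u)" if "z \<in> M" "?g z = e" for z
    proof -
      obtain u' v' where z: "z = (u', v')" by fastforce
      then have "f u' = f u \<and> f v' = f v \<or> f u' = f v \<and> f v' = f u"
        using that uv by (auto simp: doubleton_eq_iff)
      then show ?thesis using z inj MA that(1) uv(1) by (auto simp: inj_on_def)
    qed
    then have "{z \<in> M. ?g z = e} = {(u, v), (v, u)}" using uv sym by (auto simp: insert_commute)
    moreover have "u \<noteq> v" using uv(1) irr by auto
    ultimately show ?thesis by simp
  qed
  then have "(\<Sum>e\<in>?g ` M. \<Sum>z\<in>{z \<in> M. ?g z = e}. 1::nat) = (\<Sum>e\<in>?g ` M. 2)"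
    by (intro sum.cong) auto
  moreover have "card M = (\<Sum>e\<in>?g ` M. \<Sum>z\<in>{z \<in> M. ?g z = e}. 1)"
    using sum.image_gen[OF M, of "\<lambda>_. 1::nat" ?g] by simp
  ultimately show ?thesis by simp
qed

text \<open>The deleted edges are the images of the nonadjacent pairs in \<open>W\<close>. As
  \<open>H\<close> is complete on the image of \<open>W\<close> and agrees with \<open>G\<close> on
  all other pairs, these account for the whole difference.\<close>

lemma isomorphic_delete_missing_edges:
  fixes G :: "'a ugraph" and H :: "'b ugraph"
  assumes G: "simple_graph G" and H: "simple_graph H"
    and f: "bij_betw f (verts G) (verts H)" and W: "W \<subseteq> verts G"
    and outside: "\<And>u v. u \<in> verts G \<Longrightarrow> v \<in> verts G \<Longrightarrow> u \<notin> W \<or> v \<notin> W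
      \<Longrightarrow> adjacent G u v \<longleftrightarrow> adjacent H (f u) (f v)"
    and inside: "\<And>u v. u \<in> W \<Longrightarrow> v \<in> W \<Longrightarrow> u \<noteq> v \<Longrightarrow> adjacent H (f u) (f v)"
    and YZ: "f ` W \<subseteq> Y_set n H \<union> Z_set n k H"
  obtains E' where "E' \<subseteq> E0_set n k H"
    "2 * card E' = card {z \<in> W \<times> W. fst z \<noteq> snd z \<and> \<not> adjacent G (fst z) (snd z)}"
    "isomorphic G (delete_edges H E')"
proof -
  define M where "M = {z \<in> W \<times> W. fst z \<noteq> snd z \<and> \<not> adjacent G (fst z) (snd z)}"
  define E' where "E' = (\<lambda>(u, v). {f u, f v}) ` M"
  have finV: "finite (verts G)" using G by (simp add: simple_graph_def)
  have inj: "inj_on f (verts G)" using f by (simp add: bij_betw_def)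
  have sym: "symp (adjacent G)" by (rule symp_adjacent[OF G])
  have "E' \<subseteq> E0_set n k H"
    using inside YZ by (fastforce simp: E'_def M_def E0_set_def adjacent_def)
  moreover have "2 * card E' = card M" unfolding E'_def
  proof (rule card_unordered_pairs)
    show "finite M" unfolding M_def using finite_subset[OF W finV] by auto
    show "inj_on f W" using inj W by (rule inj_on_subset)
  qed (use sym in \<open>auto simp: M_def dest: sympD\<close>)
  moreover have "isomorphic G (delete_edges H E')"
    unfolding isomorphic_def
  proof (intro exI conjI ballI)
    show "bij_betw f (verts G) (verts (delete_edges H E'))" using f by (simp add: delete_edges_def)
    fix u v assume uv: "u \<in> verts G" "v \<in> verts G"
    have del: "adjacent (delete_edges H E') (f u) (f v) \<longleftrightarrow> adjacent H (f u) (f v) \<and> {f u, f v} \<notin> E'"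
      by (simp add: adjacent_def delete_edges_def)
    have E': "{f u, f v} \<in> E' \<longleftrightarrow> (u, v) \<in> M"
    proof
      assume "{f u, f v} \<in> E'"
      then obtain u' v' where z: "(u', v') \<in> M" "{f u, f v} = {f u', f v'}" by (auto simp: E'_def)
      then have V: "u' \<in> verts G" "v' \<in> verts G" using W by (auto simp: M_def)
      from z(2) have "u = u' \<and> v = v' \<or> u = v' \<and> v = u'"
        using inj uv V by (auto simp: doubleton_eq_iff inj_on_def)
      then show "(u, v) \<in> M" using z(1) sym by (auto simp: M_def dest: sympD)
    qed (force simp: E'_def)
    show "adjacent G u v \<longleftrightarrow> adjacent (delete_edges H E') (f u) (f v)"
    proof (cases "u \<in> W \<and> v \<in> W")
      case True
      show ?thesis
      proof (cases "u = v")
        case True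
        then show ?thesis using irreflp_adjacent[OF G] irreflp_adjacent[OF H] del
          by (auto simp: irreflp_def)
      next
        case False
        then show ?thesis using True inside[of u v] del E' by (auto simp: M_def)
      qed
    next
      case False
      then have "(u, v) \<notin> M" by (auto simp: M_def)
      then show ?thesis using False outside[OF uv] del E' by auto
    qed
  qed
  ultimately show ?thesis using that by (simp add: M_def)
qed

section \<open>Adjacency in joins, disjoint unions and their building blocks\<close>

lemma adjacent_graph_join [simp]:
  "adjacent (graph_join G H) (Inl u) (Inl v) \<longleftrightarrow> adjacent G u v"
  "adjacent (graph_join G H) (Inr x) (Inr y) \<longleftrightarrow> adjacent H x y"
  "adjacent (graph_join G H) (Inl u) (Inr y) \<longleftrightarrow> u \<in> verts G \<and> y \<in> verts H"
  "adjacent (graph_join G H) (Inr y) (Inl u) \<longleftrightarrow> u \<in> verts G \<and> y \<in> verts H"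
proof -
  \<comment> \<open>Writing doubletons as images turns membership in the edge set into equality of
    images under an injection.\<close>
  have 1: "{Inl u, Inl v} = Inl ` {u, v}" "{Inr x, Inr y} = Inr ` {x, y}" for u v x y by auto
  have 2: "Inl ` A = Inl ` B \<longleftrightarrow> A = B" for A B :: "'a set" by (simp add: inj_image_eq_iff)
  have 3: "Inr ` A = Inr ` B \<longleftrightarrow> A = B" for A B :: "'b set" by (simp add: inj_image_eq_iff)
  show "adjacent (graph_join G H) (Inl u) (Inl v) \<longleftrightarrow> adjacent G u v"
    "adjacent (graph_join G H) (Inr x) (Inr y) \<longleftrightarrow> adjacent H x y"
    by (auto simp: adjacent_def graph_join_def 1 2 3 simp del: image_insert image_empty)
  show "adjacent (graph_join G H) (Inl u) (Inr y) \<longleftrightarrow> u \<in> verts G \<and> y \<in> verts H"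
    "adjacent (graph_join G H) (Inr y) (Inl u) \<longleftrightarrow> u \<in> verts G \<and> y \<in> verts H"
    by (auto simp: adjacent_def graph_join_def doubleton_eq_iff)
qed

lemma adjacent_disjoint_union [simp]:
  "adjacent (disjoint_union G H) (Inl u) (Inl v) \<longleftrightarrow> adjacent G u v"
  "adjacent (disjoint_union G H) (Inr x) (Inr y) \<longleftrightarrow> adjacent H x y"
  "\<not> adjacent (disjoint_union G H) (Inl u) (Inr y)"
  "\<not> adjacent (disjoint_union G H) (Inr y) (Inl u)"
proof -
  have 1: "{Inl u, Inl v} = Inl ` {u, v}" "{Inr x, Inr y} = Inr ` {x, y}" for u v x y by auto
  have 2: "Inl ` A = Inl ` B \<longleftrightarrow> A = B" for A B :: "'a set" by (simp add: inj_image_eq_iff)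
  have 3: "Inr ` A = Inr ` B \<longleftrightarrow> A = B" for A B :: "'b set" by (simp add: inj_image_eq_iff)
  show "adjacent (disjoint_union G H) (Inl u) (Inl v) \<longleftrightarrow> adjacent G u v"
    "adjacent (disjoint_union G H) (Inr x) (Inr y) \<longleftrightarrow> adjacent H x y"
    by (auto simp: adjacent_def disjoint_union_def 1 2 3 simp del: image_insert image_empty)
  show "\<not> adjacent (disjoint_union G H) (Inl u) (Inr y)" 
    "\<not> adjacent (disjoint_union G H) (Inr y) (Inl u)"
    by (auto simp: adjacent_def disjoint_union_def)
qed

lemma adjacent_complete_graph [simp]:
  "adjacent (complete_graph m) i j \<longleftrightarrow> i < m \<and> j < m \<and> i \<noteq> j"
  by (auto simp: adjacent_def complete_graph_def doubleton_eq_iff)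

lemma adjacent_edgeless_graph [simp]: "\<not> adjacent (edgeless_graph m) i j"
  by (simp add: adjacent_def edgeless_graph_def)

lemma verts_constructions [simp]:
  "verts (complete_graph m) = {..<m}" "verts (edgeless_graph m) = {..<m}"
  "verts (graph_join G H) = verts G <+> verts H" "verts (disjoint_union G H) = verts G <+> verts H"
  by (simp_all add: complete_graph_def edgeless_graph_def graph_join_def disjoint_union_def)

lemma simple_complete_graph: "simple_graph (complete_graph m)"
  by (auto simp: simple_graph_def complete_graph_def)

lemma simple_edgeless_graph: "simple_graph (edgeless_graph m)"
  by (auto simp: simple_graph_def edgeless_graph_def)

lemma simple_graph_join:
  assumes "simple_graph G" "simple_graph H"
  shows "simple_graph (graph_join G H)"
  using assms by (auto simp: simple_graph_def graph_join_def card_image)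

lemma simple_disjoint_union:
  assumes "simple_graph G" "simple_graph H"
  shows "simple_graph (disjoint_union G H)"
  using assms by (auto simp: simple_graph_def disjoint_union_def card_image)

text \<open>One construction serves both families: \<open>C\<close> is edgeless for
  \<open>S_graph\<close> and complete for \<open>T_graph\<close>. \<open>LL\<close> ranges over all
  bijections because the one used is chosen only in the proof, and either kind of \<open>C\<close>
  is insensitive to the choice.\<close>

lemma isomorphic_join_minus_edges:
  fixes G :: "'a ugraph" and C :: "nat ugraph"
  assumes G: "simple_graph G" and C: "simple_graph C" "verts C = {..<c}"
    and L: "L \<subseteq> verts G" "card L = c" and Y: "Y \<subseteq> verts G - L" "card Y = a"
    and b: "card (verts G - L - Y) = b"
    and LW: "\<And>v w. v \<in> L \<Longrightarrow> w \<in> verts G - L \<Longrightarrow> adjacent G v w \<longleftrightarrow> w \<in> Y"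
    and LL: "\<And>h u v. bij_betw h L {..<c} \<Longrightarrow> u \<in> L \<Longrightarrow> v \<in> L
      \<Longrightarrow> adjacent G u v \<longleftrightarrow> adjacent C (h u) (h v)"
    and n: "n = a + b + c" and k: "n - k = a + b - 1"
  defines "H \<equiv> graph_join (complete_graph a) (disjoint_union (complete_graph b) C)"
    and "W \<equiv> verts G - L"
  obtains E' where "E' \<subseteq> E0_set n k H"
    "2 * card E' = card {z \<in> W \<times> W. fst z \<noteq> snd z \<and> \<not> adjacent G (fst z) (snd z)}"
    "isomorphic G (delete_edges H E')"
proof -
  let ?Z = "verts G - L - Y"
  have finV: "finite (verts G)" using G by (simp add: simple_graph_def)
  have H: "simple_graph H" unfolding H_def
    by (intro simple_graph_join simple_disjoint_union simple_complete_graph C)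
  have bij: "\<exists>h. bij_betw h A {..<card A}" if "A \<subseteq> verts G" for A
    using ex_bij_betw_finite_nat[OF finite_subset[OF that finV]] by (simp add: atLeast0LessThan)
  obtain hL hY hZ where h: "bij_betw hL L {..<c}" "bij_betw hY Y {..<a}" "bij_betw hZ ?Z {..<b}"
    using bij[of L] bij[of Y] bij[of ?Z] L Y b by blast
  have hin: "v \<in> L \<Longrightarrow> hL v < c" "v \<in> Y \<Longrightarrow> hY v < a" "v \<in> ?Z \<Longrightarrow> hZ v < b" for v
    using h by (auto simp: bij_betw_def)
  define f :: "'a \<Rightarrow> nat + nat + nat" where
    "f v = (if v \<in> L then Inr (Inr (hL v)) else if v \<in> Y then Inl (hY v) else Inr (Inl (hZ v)))" for v
  have vH: "verts H = {..<a} <+> ({..<b} <+> {..<c})" using C by (simp add: H_def)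
  have f: "bij_betw f (verts G) (verts H)"
    unfolding bij_betw_def
  proof
    show "inj_on f (verts G)"
      using h by (auto simp: inj_on_def f_def bij_betw_def split: if_splits)
    have "verts G = Y \<union> ?Z \<union> L" using L Y by auto
    then have "f ` verts G = f ` Y \<union> f ` ?Z \<union> f ` L" by (metis image_Un)
    also have "f ` Y = (\<lambda>v. Inl (hY v)) ` Y" by (intro image_cong) (use Y in \<open>auto simp: f_def\<close>)
    also have "\<dots> = Inl ` {..<a}" using h(2) by (auto simp: bij_betw_def image_image[symmetric])
    also have "f ` ?Z = (\<lambda>v. Inr (Inl (hZ v))) ` ?Z" by (intro image_cong) (auto simp: f_def)
    also have "\<dots> = (\<lambda>i. Inr (Inl i)) ` hZ ` ?Z" by (simp add: image_image)
    also have "hZ ` ?Z = {..<b}" using h(3) by (simp add: bij_betw_def)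
    also have "f ` L = (\<lambda>v. Inr (Inr (hL v))) ` L" by (intro image_cong) (auto simp: f_def)
    also have "\<dots> = (\<lambda>i. Inr (Inr i)) ` hL ` L" by (simp add: image_image)
    also have "hL ` L = {..<c}" using h(1) by (simp add: bij_betw_def)
    finally show "f ` verts G = verts H" unfolding vH by auto
  qed
  have dY: "vertex_degree H (Inl i) = n - 1" if i: "i < a" for i
  proof -
    have "adjacent H (Inl i) z \<longleftrightarrow> z \<noteq> Inl i" if "z \<in> verts H" for z
      using that i unfolding vH by (elim PlusE) (auto simp: H_def C(2))
    then have "nbrs (verts H) (adjacent H) (Inl i) = verts H - {Inl i}" by (auto simp: nbrs_def)
    moreover have "card (verts H) = n" unfolding vH n by (simp add: card_Plus)
    moreover have "Inl i \<in> verts H" using i by (auto simp: vH)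
    ultimately show ?thesis by (simp add: vertex_degree_eq[OF H])
  qed
  \<comment> \<open>Such a vertex sees the \<open>a\<close> vertices of the first clique and the
    \<open>b - 1\<close> others of its own, and \<open>a + b - 1 = n - k\<close> places it in
    \<open>Z_set\<close>.\<close>
  have dZ: "vertex_degree H (Inr (Inl i)) = n - k" if i: "i < b" for i
  proof -
    have "adjacent H (Inr (Inl i)) z \<longleftrightarrow> z \<in> {..<a} <+> Inl ` ({..<b} - {i})"
      if "z \<in> verts H" for z
      using that i unfolding vH by (elim PlusE) (auto simp: H_def C(2))
    moreover have "{..<a} <+> Inl ` ({..<b} - {i}) \<subseteq> verts H" unfolding vH by auto
    ultimately have "nbrs (verts H) (adjacent H) (Inr (Inl i)) = {..<a} <+> Inl ` ({..<b} - {i})"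
      unfolding nbrs_def by blast
    moreover have "card ({..<a} <+> (Inl ` ({..<b} - {i}) :: (nat + nat) set)) = a + (b - 1)"
      using i by (simp add: card_Plus card_image)
    ultimately show ?thesis using i k by (simp add: vertex_degree_eq[OF H])
  qed
  show ?thesis
  proof (rule isomorphic_delete_missing_edges[OF G H f, of W n k])
    show "W \<subseteq> verts G" by (auto simp: W_def)
    show "f ` W \<subseteq> Y_set n H \<union> Z_set n k H"
    proof
      fix x assume "x \<in> f ` W"
      then obtain w where w: "w \<in> W" "x = f w" by auto
      then show "x \<in> Y_set n H \<union> Z_set n k H"
        using hin dY dZ by (cases "w \<in> Y") (auto simp: W_def f_def Y_set_def Z_set_def vH)
    qed
    show "adjacent H (f u) (f v)" if "u \<in> W" "v \<in> W" "u \<noteq> v" for u v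
      using that hin h Y by (auto simp: W_def f_def H_def C bij_betw_def inj_on_def)
    have one: "adjacent G u v \<longleftrightarrow> adjacent H (f u) (f v)" if "u \<in> L" "v \<in> verts G" for u v
    proof (cases "v \<in> L")
      case True
      then show ?thesis using that LL[OF h(1)] by (simp add: f_def H_def)
    next
      case False
      then show ?thesis using that LW[of u v] hin by (auto simp: f_def H_def C)
    qed
    show "adjacent G u v \<longleftrightarrow> adjacent H (f u) (f v)"
      if "u \<in> verts G" "v \<in> verts G" "u \<notin> W \<or> v \<notin> W" for u v
    proof (cases "u \<in> L")
      case False
      then have "v \<in> L" using that by (auto simp: W_def)
      then have "adjacent G v u \<longleftrightarrow> adjacent H (f v) (f u)" using one that by blast
      then show ?thesis using symp_adjacent[OF G] symp_adjacent[OF H] by (metis sympD)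
    qed (use one that in blast)
  qed (rule that)
qed

section \<open>The theorem\<close>

lemma hamilton_connected_eq:
  "hamilton_connected G \<longleftrightarrow> ham_conn (verts G) (adjacent G)"
  by (simp add: hamilton_connected_def hamilton_path_def ham_conn_def ham_path_def)

text \<open>These are the numerical conditions of the structural lemma and of
  \<open>missing_pairs_le\<close> for \<open>card W = n - k + 1\<close>. The left sides of the last
  two increase with \<open>s\<close>, so they are evaluated at \<open>s = k (k - 1)\<close>.\<close>

lemma size_bounds:
  fixes k n :: nat and s :: real
  assumes k: "k \<ge> 2" and n: "n \<ge> k ^ 4 + 5 * k ^ 3 + 2 * k ^ 2 + 8 * k + 12"
    and s: "0 \<le> s" "s \<le> real k * (real k - 1)"
  shows "k * (8 * k + 1) < n"
    and "(s + 3)\<^sup>2 + 4 * (2 * s + 3) * (real k - 1) < 2 * (real n - real k + 1)"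
    and "real k * (2 * s + 4) < real n - real k"
proof -
  define m where "m = real k"
  have m: "m \<ge> 2" using k by (simp add: m_def)
  have N: "real n \<ge> m ^ 4 + 5 * m ^ 3 + 2 * m ^ 2 + 8 * m + 12"
  proof -
    have "real n \<ge> real (k ^ 4 + 5 * k ^ 3 + 2 * k ^ 2 + 8 * k + 12)" using n by (simp only: of_nat_le_iff)
    then show ?thesis by (simp add: m_def)
  qed
  have p2: "m\<^sup>2 \<ge> 2 * m" using m by (simp add: power2_eq_square)
  have p3: "m ^ 3 \<ge> 2 * m\<^sup>2" using m by (simp add: power2_eq_square power3_eq_cube)
  have p4: "m ^ 4 \<ge> 2 * m ^ 3" using m by (simp add: power4_eq_xxxx power3_eq_cube)
  have "m * (8 * m + 1) < real n" using N p2 p3 p4 m by (simp add: power2_eq_square algebra_simps)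
  then have "real (k * (8 * k + 1)) < real n" by (simp add: m_def algebra_simps)
  then show "k * (8 * k + 1) < n" by (simp only: of_nat_less_iff)
  have "(s + 3)\<^sup>2 \<le> (m * (m - 1) + 3)\<^sup>2" using s by (intro power_mono) (auto simp: m_def)
  moreover have "4 * (2 * s + 3) * (m - 1) \<le> 4 * (2 * (m * (m - 1)) + 3) * (m - 1)"
    using s m by (intro mult_right_mono) (auto simp: m_def)
  ultimately have "(s + 3)\<^sup>2 + 4 * (2 * s + 3) * (m - 1)
      \<le> (m * (m - 1) + 3)\<^sup>2 + 4 * (2 * (m * (m - 1)) + 3) * (m - 1)"
    by (rule add_mono)
  also have "\<dots> = m ^ 4 + 6 * m ^ 3 - 9 * m\<^sup>2 + 14 * m - 3"
    by (simp add: power2_eq_square power3_eq_cube power4_eq_xxxx algebra_simps)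
  also have "\<dots> < 2 * (real n - m + 1)"
  proof -
    \<comment> \<open>With the powers of \<open>m\<close> replaced by free variables the inequality
      is linear.\<close>
    have "A + 6 * B - 9 * C + 14 * m - 3 < 2 * (real n - m + 1)"
      if "real n \<ge> A + 5 * B + 2 * C + 8 * m + 12" "C \<ge> 2 * m" "B \<ge> 2 * C" "A \<ge> 2 * B"
      for A B C
    proof -
      have "0 \<le> A" "0 \<le> B" "0 \<le> C" using that(2-4) m by linarith+
      then show ?thesis using that(1) by argo
    qed
    then show ?thesis using N p2 p3 p4 .
  qed
  finally show "(s + 3)\<^sup>2 + 4 * (2 * s + 3) * (real k - 1) < 2 * (real n - real k + 1)"
    by (simp only: m_def)
  have "m * (2 * s + 4) \<le> m * (2 * (m * (m - 1)) + 4)"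
    using s m by (intro mult_left_mono) (auto simp: m_def)
  also have "\<dots> = 2 * m ^ 3 - 2 * m\<^sup>2 + 4 * m"
    by (simp add: power2_eq_square power3_eq_cube algebra_simps)
  finally show "real k * (2 * s + 4) < real n - real k"
    using N p2 p3 p4 m by (simp add: m_def[symmetric])
qed

theorem theorem1p1:
  fixes G :: "'a ugraph" and n k :: nat
  assumes "k \<ge> 2"
    and "simple_graph G"
    and "card (verts G) = n"
    and "n \<ge> k ^ 4 + 5 * k ^ 3 + 2 * k ^ 2 + 8 * k + 12"
    and "min_degree G \<ge> k"
    and "Q_index G \<ge> 2 * real n - 2 * real k"
  shows "hamilton_connected G \<or> G \<in> S1_family k n \<union> T1_family k n"
proof (rule disj_imp[THEN iffD2], rule impI)
  assume nhc: "\<not> hamilton_connected G"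
  note k = assms(1) and G = assms(2)
  let ?V = "verts G" and ?R = "adjacent G" and ?q = "Q_index G"
  have V: "finite ?V" "card ?V = n" using G assms(3) by (auto simp: simple_graph_def)
  have sym: "symp ?R" and irr: "irreflp ?R" using symp_adjacent[OF G] irreflp_adjacent[OF G] by auto
  have ne: "?V \<noteq> {}" using V assms(4) by auto
  have deg: "k \<le> card (nbrs ?V ?R v)" if "v \<in> ?V" for v
  proof -
    have "min_degree G \<le> vertex_degree G v" unfolding min_degree_def using V that by (intro Min_le) auto
    then show ?thesis using assms(5) by (simp add: vertex_degree_eq[OF G])
  qed
  obtain vs where vs: "vertex_ordering G vs" "eigenvalue (signless_laplacian G vs) ?q"
    using Q_index_eigenvalue[OF G ne] .
  obtain x where x: "\<exists>v \<in> ?V. x v \<noteq> 0"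
    "\<forall>v \<in> ?V. ?q * x v = real (card (nbrs ?V ?R v)) * x v + (\<Sum>w\<in>nbrs ?V ?R v. x w)"
    using signless_laplacian_eigenfunction[OF G vs] .
  have k1: "k \<ge> 1" using k by simp
  have kn: "k * (8 * k + 1) < n" using size_bounds(1)[OF k assms(4), of 0] k by simp
  have nonadj: "card {z \<in> ?V \<times> ?V. fst z \<noteq> snd z \<and> \<not> ?R (fst z) (snd z)} \<le> 2 * (k - 1) * n"
    by (rule nonadjacent_pairs_le[OF V irr k1 deg bspec[OF x(2)] x(1) assms(6)])
  obtain L Y where L: "L \<subseteq> ?V" "card L = k - 1" and YV: "Y \<subseteq> ?V - L"
    and LW: "\<And>v w. v \<in> L \<Longrightarrow> w \<in> ?V - L \<Longrightarrow> ?R v w \<longleftrightarrow> w \<in> Y"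
    and alt: "card Y = k \<and> (\<forall>u \<in> L. \<forall>v \<in> L. \<not> ?R u v) \<or>
     card Y = 2 \<and> (\<forall>u \<in> L. \<forall>v \<in> L. u \<noteq> v \<longrightarrow> ?R u v)"
    by (rule non_ham_conn_structure[OF V sym irr k kn deg nonadj])
      (use nhc in \<open>auto simp: hamilton_connected_eq\<close>)
  define W where "W = ?V - L"
  have finL: "finite L" and finY: "finite Y" and finW: "finite W"
    using V L YV by (auto simp: W_def intro: finite_subset)
  have VLW: "?V = L \<union> W" using L by (auto simp: W_def)
  have k8: "2 * k \<le> k * (8 * k + 1)" using k by simp
  have k2n: "2 * k < n" using kn k8 by linarith
  have cW: "card W = n - (k - 1)" using V L finL by (simp add: W_def card_Diff_subset)
  have cWr: "real (card W) = real n - real k + 1" using cW k2n k by (simp add: of_nat_diff)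
  have cZ: "card (?V - L - Y) = n - (k - 1) - card Y"
    using cW finY YV by (simp add: W_def card_Diff_subset)
  \<comment> \<open>Since \<open>L\<close> is joined to exactly \<open>Y\<close>, the count is
    \<open>k (k - 1)\<close> or \<open>2 (k - 1)\<close> in the two cases.\<close>
  define s where "s = card {z \<in> L \<times> W. ?R (fst z) (snd z)}"
  have s: "s = (k - 1) * card Y"
  proof -
    have "{z \<in> L \<times> W. ?R (fst z) (snd z)} = L \<times> Y" using LW YV by (auto simp: W_def)
    then show ?thesis by (simp add: s_def card_cartesian_product L)
  qed
  have yk: "card Y \<le> k" using alt k by auto
  have sk: "real s \<le> real k * (real k - 1)"
  proof -
    have "s \<le> (k - 1) * k" unfolding s using yk by simp
    then have "real s \<le> real ((k - 1) * k)" by (simp only: of_nat_le_iff)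
    then show ?thesis using k by (simp add: of_nat_diff mult.commute)
  qed
  have degL: "card (nbrs ?V ?R i) \<le> k" if i: "i \<in> L" for i
    using alt
  proof
    assume c: "card Y = k \<and> (\<forall>u \<in> L. \<forall>v \<in> L. \<not> ?R u v)"
    then have "nbrs ?V ?R i \<subseteq> Y" using LW i by (auto simp: nbrs_def)
    then show ?thesis using c finY card_mono by metis
  next
    assume c: "card Y = 2 \<and> (\<forall>u \<in> L. \<forall>v \<in> L. u \<noteq> v \<longrightarrow> ?R u v)"
    have "nbrs ?V ?R i \<subseteq> Y \<union> (L - {i})" using LW i irr by (auto simp: nbrs_def irreflp_def)
    then have "card (nbrs ?V ?R i) \<le> card (Y \<union> (L - {i}))" using finY finL by (intro card_mono) auto
    also have "\<dots> \<le> card Y + card (L - {i})" by (rule card_Un_le)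
    also have "\<dots> = k" using c i L finL k by simp
    finally show ?thesis .
  qed
  define M where "M = {z \<in> W \<times> W. fst z \<noteq> snd z \<and> \<not> ?R (fst z) (snd z)}"
  have "2 * card M \<le> s + 1"
    unfolding s_def M_def
  proof (rule missing_pairs_le[OF finL finW _ sym irr L(2) k1])
    show "?q \<ge> 2 * (real (card W) - 1)" using assms(6) cWr by simp
    show "(real (card {z \<in> L \<times> W. ?R (fst z) (snd z)}) + 3)\<^sup>2
        + 4 * (2 * real (card {z \<in> L \<times> W. ?R (fst z) (snd z)}) + 3) * (real k - 1)
        < 2 * real (card W)"
      using size_bounds(2)[OF k assms(4) _ sk] cWr by (simp add: s_def)
    show "real k * (2 * real (card {z \<in> L \<times> W. ?R (fst z) (snd z)}) + 4) < real (card W) - 1"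
      using size_bounds(3)[OF k assms(4) _ sk] cWr by (simp add: s_def)
  qed (use x degL VLW[symmetric] in \<open>auto simp: W_def\<close>)
  from alt show "G \<in> S1_family k n \<union> T1_family k n"
  proof
    assume c: "card Y = k \<and> (\<forall>u \<in> L. \<forall>v \<in> L. \<not> ?R u v)"
    have cZ': "card (?V - L - Y) = n - (2 * k - 1)" using cZ c k by simp
    obtain E' where E': "E' \<subseteq> E0_set n k (S_graph n k)" "2 * card E' = card M"
      "isomorphic G (delete_edges (S_graph n k) E')"
      unfolding S_graph_def M_def W_def
    proof (rule isomorphic_join_minus_edges[OF G simple_edgeless_graph _ L YV _ cZ' LW])
      show "n = k + (n - (2 * k - 1)) + (k - 1)" "n - k = k + (n - (2 * k - 1)) - 1"
        using k2n k by auto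
    qed (use c in auto)
    have "4 * card E' \<le> k * (k - 1) + 1"
      using \<open>2 * card M \<le> s + 1\<close> E'(2) s c by (simp add: mult.commute)
    \<comment> \<open>Parity removes the extra 1 and so gives the exact bound of the family.\<close>
    moreover have "even (k * (k - 1))" using k by (cases "even k") auto
    ultimately have "4 * card E' \<le> k * (k - 1)" by presburger
    then have "card E' \<le> k * (k - 1) div 4" by simp
    then show ?thesis using E' by (auto simp: S1_family_def)
  next
    assume c: "card Y = 2 \<and> (\<forall>u \<in> L. \<forall>v \<in> L. u \<noteq> v \<longrightarrow> ?R u v)"
    have cZ': "card (?V - L - Y) = n - (k + 1)" using cZ c k by simp
    obtain E' where E': "E' \<subseteq> E0_set n k (T_graph n k)" "2 * card E' = card M"
      "isomorphic G (delete_edges (T_graph n k) E')"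
      unfolding T_graph_def M_def W_def
    proof (rule isomorphic_join_minus_edges[OF G simple_complete_graph _ L YV _ cZ' LW])
      show "n = 2 + (n - (k + 1)) + (k - 1)" "n - k = 2 + (n - (k + 1)) - 1"
        using k2n k by auto
      fix h u v assume h: "bij_betw h L {..<k - 1}" and uv: "u \<in> L" "v \<in> L"
      have "h u < k - 1" "h v < k - 1" using h uv by (auto simp: bij_betw_def)
      moreover have "h u = h v \<longleftrightarrow> u = v" using h uv by (auto simp: bij_betw_def inj_on_def)
      ultimately show "?R u v \<longleftrightarrow> adjacent (complete_graph (k - 1)) (h u) (h v)"
        using c uv irr by (auto simp: irreflp_def)
    qed (use c in auto)
    \<comment> \<open>Here \<open>4 * card E' \<le> 2 (k - 1) + 1\<close>, and both
      \<open>4 * card E'\<close> and \<open>2 (k - 1)\<close> are even.\<close>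
    have "2 * card E' \<le> k - 1"
      using \<open>2 * card M \<le> s + 1\<close> E'(2) s c by simp
    then have "card E' \<le> (k - 1) div 2" by simp
    then show ?thesis using E' by (auto simp: T1_family_def)
  qed
qed

end
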